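(* Let $p,q\in\mathbb{F}[t]$ be monic polynomials of degree $2$, and assume that $p$ and $q$ are irreducible over $\mathbb{F}$, with distinct splitting fields in $\overline{\mathbb{F}}$. Assume furthermore that the characteristic of $\mathbb{F}$ is not $2$, or $\operatorname{tr}(p)=\operatorname{tr}(q)=0$, or $\operatorname{tr}(p)\neq\operatorname{tr}(q)$. Then for every $(p,q)$-exceptional endomorphism $v$ of a vector space over $\mathbb{F}$, the symplectic pair $S(v)$ is a symplectic $(p,q)$-difference.
   Context: $\mathbb{F}$ is an arbitrary field, with a fixed algebraic closure $\overline{\mathbb{F}}$; all vector spaces are finite-dimensional over $\mathbb{F}$. For a monic polynomial $r\in\mathbb{F}[t]$ of degree $n>0$, $\operatorname{tr}r$ is the opposite of the coefficient of $r$ on $t^{n-1}$, and $\operatorname{Root}(r)$ is the set of roots of $r$ in $\overline{\mathbb{F}}$; $\operatorname{Root}(p)-\operatorname{Root}(q):=\{x-y : x\in\operatorname{Root}(p),\,y\in\operatorname{Root}(q)\}$. An endomorphism is $(p,q)$-exceptional if all its eigenvalues in $\overline{\mathbb{F}}$ belong to $\operatorname{Root}(p)-\operatorname{Root}(q)$. A symplectic form is a non-degenerate alternating bilinear form. Given a symplectic form $b$ on $V$, an endomorphism $u$ of $V$ is $b$-alternating if $b(x,u(x))=0$ for all $x\in V$. A symplectic pair $(b,u)$ consists of a symplectic form $b$ on a vector space and a $b$-alternating endomorphism $u$ of it. It is a symplectic $(p,q)$-difference if there are $b$-alternating endomorphisms $u_1,u_2$ with $u=u_1-u_2$, $p(u_1)=0$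 and $q(u_2)=0$. For an endomorphism $v$ of $V$ with transpose $v^t:\varphi\mapsto\varphi\circ v$ on the dual space $V^\star$, put $h(v):=v\oplus v^t$ on $V\times V^\star$ and $S_V((x,\varphi),(y,\psi)):=\varphi(y)-\psi(x)$. The symplectic extension of $v$ is the symplectic pair $S(v):=(S_V,h(v))$. *)

theory Defs
  imports
    "HOL-Algebra.Algebraic_Closure_Type"
    "HOL-Algebra.Generated_Fields"
    "HOL-Library.Function_Algebras"
    "HOL-Library.Product_Plus"
    "Jordan_Normal_Form.Char_Poly"
begin

text \<open>
  The fixed algebraic closure of the ground field \<open>'a\<close> is the type \<open>'a alg_closure\<close>, with
  embedding \<open>to_ac\<close>.
\<close>

definition Root :: "'a::field poly \<Rightarrow> 'a alg_closure set" where
  "Root r = {x. poly (map_poly to_ac r) x = 0}"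

definition root_differences :: "'a::field poly \<Rightarrow> 'a poly \<Rightarrow> 'a alg_closure set" where
  "root_differences p q = {x - y | x y. x \<in> Root p \<and> y \<in> Root q}"

definition splitting_field :: "'a::field poly \<Rightarrow> 'a alg_closure set" where
  "splitting_field r = generate_field ring_of_type_algebra (range to_ac \<union> Root r)"

text \<open>Only meaningful for monic polynomials of positive degree.\<close>

definition tr :: "'a::field poly \<Rightarrow> 'a" where
  "tr r = - Polynomial.coeff r (Polynomial.degree r - 1)"

definition ordered_basis :: "('a::field \<Rightarrow> 'v::ab_group_add \<Rightarrow> 'v) \<Rightarrow> 'v list \<Rightarrow> bool" where
  "ordered_basis scale bs \<longleftrightarrow>
     distinct bs \<and> \<not> module.dependent scale (set bs) \<and> module.span scale (set bs) = UNIV"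

definition matrix_of :: "('a::field \<Rightarrow> 'v::ab_group_add \<Rightarrow> 'v) \<Rightarrow> 'v list \<Rightarrow> ('v \<Rightarrow> 'v) \<Rightarrow> 'a mat" where
  "matrix_of scale bs v =
     mat (length bs) (length bs)
       (\<lambda>(i, j). module.representation scale (set bs) (v (bs ! j)) (bs ! i))"

text \<open>
  The eigenvalues of \<open>v\<close> in the algebraic closure are those of its extension of scalars, that is,
  of a matrix of \<open>v\<close> with entries regarded in the algebraic closure. They do not depend on the
  ordered basis.
\<close>

definition ac_eigenvalues ::
    "('a::field \<Rightarrow> 'v::ab_group_add \<Rightarrow> 'v) \<Rightarrow> ('v \<Rightarrow> 'v) \<Rightarrow> 'a alg_closure set" where
  "ac_eigenvalues scale v =
     {l. \<exists>bs. ordered_basis scale bs \<and> eigenvalue (map_mat to_ac (matrix_of scale bs v)) l}"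

definition exceptional ::
    "('a::field \<Rightarrow> 'v::ab_group_add \<Rightarrow> 'v) \<Rightarrow> 'a poly \<Rightarrow> 'a poly \<Rightarrow> ('v \<Rightarrow> 'v) \<Rightarrow> bool" where
  "exceptional scale p q v \<longleftrightarrow> ac_eigenvalues scale v \<subseteq> root_differences p q"

text \<open>
  The dual of a vector space is a subspace of a function space rather than a type of its own.
  So the notions around symplectic forms are given for a subspace \<open>W\<close> of an ambient vector space;
  only the values on \<open>W\<close> of forms and endomorphisms matter.
\<close>

definition fin_dim_space :: "('a::field \<Rightarrow> 'w::ab_group_add \<Rightarrow> 'w) \<Rightarrow> 'w set \<Rightarrow> bool" where
  "fin_dim_space scale W \<longleftrightarrow>
     vector_space scale \<and> module.subspace scale W \<and> (\<exists>B. finite B \<and> module.span scale B = W)"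

definition endomorphism_on ::
    "('a::field \<Rightarrow> 'w::ab_group_add \<Rightarrow> 'w) \<Rightarrow> 'w set \<Rightarrow> ('w \<Rightarrow> 'w) \<Rightarrow> bool" where
  "endomorphism_on scale W u \<longleftrightarrow>
     (\<forall>x\<in>W. u x \<in> W) \<and>
     (\<forall>x\<in>W. \<forall>y\<in>W. u (x + y) = u x + u y) \<and>
     (\<forall>c. \<forall>x\<in>W. u (scale c x) = scale c (u x))"

definition bilinear_on ::
    "('a::field \<Rightarrow> 'w::ab_group_add \<Rightarrow> 'w) \<Rightarrow> 'w set \<Rightarrow> ('w \<Rightarrow> 'w \<Rightarrow> 'a) \<Rightarrow> bool" where
  "bilinear_on scale W b \<longleftrightarrow>
     (\<forall>x\<in>W. \<forall>y\<in>W. \<forall>z\<in>W. b (x + y) z = b x z + b y z \<and> b z (x + y) = b z x + b z y) \<and>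
     (\<forall>c. \<forall>x\<in>W. \<forall>y\<in>W. b (scale c x) y = c * b x y \<and> b x (scale c y) = c * b x y)"

definition symplectic_form ::
    "('a::field \<Rightarrow> 'w::ab_group_add \<Rightarrow> 'w) \<Rightarrow> 'w set \<Rightarrow> ('w \<Rightarrow> 'w \<Rightarrow> 'a) \<Rightarrow> bool" where
  "symplectic_form scale W b \<longleftrightarrow>
     bilinear_on scale W b \<and>
     (\<forall>x\<in>W. b x x = 0) \<and>
     (\<forall>x\<in>W. (\<forall>y\<in>W. b x y = 0) \<longrightarrow> x = 0)"

definition alternating_endomorphism ::
    "('a::field \<Rightarrow> 'w::ab_group_add \<Rightarrow> 'w) \<Rightarrow> 'w set \<Rightarrow> ('w \<Rightarrow> 'w \<Rightarrow> 'a) \<Rightarrow> ('w \<Rightarrow> 'w) \<Rightarrow> bool" where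
  "alternating_endomorphism scale W b u \<longleftrightarrow>
     endomorphism_on scale W u \<and> (\<forall>x\<in>W. b x (u x) = 0)"

definition symplectic_pair ::
    "('a::field \<Rightarrow> 'w::ab_group_add \<Rightarrow> 'w) \<Rightarrow> 'w set \<Rightarrow> ('w \<Rightarrow> 'w \<Rightarrow> 'a) \<times> ('w \<Rightarrow> 'w) \<Rightarrow> bool" where
  "symplectic_pair scale W = (\<lambda>(b, u).
     fin_dim_space scale W \<and> symplectic_form scale W b \<and> alternating_endomorphism scale W b u)"

definition poly_endo ::
    "('a::field \<Rightarrow> 'w::ab_group_add \<Rightarrow> 'w) \<Rightarrow> 'a poly \<Rightarrow> ('w \<Rightarrow> 'w) \<Rightarrow> 'w \<Rightarrow> 'w" where
  "poly_endo scale r u x = (\<Sum>i\<le>Polynomial.degree r. scale (Polynomial.coeff r i) ((u ^^ i) x))"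

definition symplectic_difference ::
    "('a::field \<Rightarrow> 'w::ab_group_add \<Rightarrow> 'w) \<Rightarrow> 'w set \<Rightarrow> 'a poly \<Rightarrow> 'a poly \<Rightarrow>
     ('w \<Rightarrow> 'w \<Rightarrow> 'a) \<times> ('w \<Rightarrow> 'w) \<Rightarrow> bool" where
  "symplectic_difference scale W p q = (\<lambda>(b, u).
     symplectic_pair scale W (b, u) \<and>
     (\<exists>u1 u2. alternating_endomorphism scale W b u1 \<and> alternating_endomorphism scale W b u2 \<and>
        (\<forall>x\<in>W. u x = u1 x - u2 x) \<and>
        (\<forall>x\<in>W. poly_endo scale p u1 x = 0) \<and>
        (\<forall>x\<in>W. poly_endo scale q u2 x = 0)))"

definition dual :: "('a::field \<Rightarrow> 'v::ab_group_add \<Rightarrow> 'v) \<Rightarrow> ('v \<Rightarrow> 'a) set" where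
  "dual scale = {\<phi>. Vector_Spaces.linear scale (*) \<phi>}"

definition double_space ::
    "('a::field \<Rightarrow> 'v::ab_group_add \<Rightarrow> 'v) \<Rightarrow> ('v \<times> ('v \<Rightarrow> 'a)) set" where
  "double_space scale = UNIV \<times> dual scale"

definition double_scale ::
    "('a::field \<Rightarrow> 'v::ab_group_add \<Rightarrow> 'v) \<Rightarrow> 'a \<Rightarrow> 'v \<times> ('v \<Rightarrow> 'a) \<Rightarrow> 'v \<times> ('v \<Rightarrow> 'a)" where
  "double_scale scale c = (\<lambda>(x, \<phi>). (scale c x, \<lambda>y. c * \<phi> y))"

definition double_form :: "'v \<times> ('v \<Rightarrow> 'a::field) \<Rightarrow> 'v \<times> ('v \<Rightarrow> 'a) \<Rightarrow> 'a" where
  "double_form = (\<lambda>(x, \<phi>) (y, \<psi>). \<phi> y - \<psi> x)"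

definition double_endo :: "('v \<Rightarrow> 'v) \<Rightarrow> 'v \<times> ('v \<Rightarrow> 'a::field) \<Rightarrow> 'v \<times> ('v \<Rightarrow> 'a)" where
  "double_endo v = (\<lambda>(x, \<phi>). (v x, \<phi> \<circ> v))"

definition symplectic_extension ::
    "('v \<Rightarrow> 'v) \<Rightarrow> ('v \<times> ('v \<Rightarrow> 'a::field) \<Rightarrow> 'v \<times> ('v \<Rightarrow> 'a) \<Rightarrow> 'a) \<times>
                  ('v \<times> ('v \<Rightarrow> 'a) \<Rightarrow> 'v \<times> ('v \<Rightarrow> 'a))" where
  "symplectic_extension v = (double_form, double_endo v)"

end

theory Submission
  imports Defs
begin

text \<open>
  Write \<open>p = t\<^sup>2 - l t + \<alpha>\<close> and \<open>q = t\<^sup>2 - m t + \<beta>\<close>. It suffices to find a symplectic form \<open>N\<close> on \<open>V\<close>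
  and a splitting \<open>v = D - E\<close> with \<open>D\<^sup>2 = l D\<close> and \<open>E\<^sup>2 = m E - (\<beta> - \<alpha>)\<close> such that the \<open>N\<close>-adjoints
  of \<open>D\<close> and \<open>E\<close> are \<open>l - D\<close> and \<open>m - E\<close>. Then \<open>(D, -\<alpha> N\<inverse>; N, D\<^sup>t)\<close> and \<open>(E, -\<alpha> N\<inverse>; N, E\<^sup>t)\<close>
  on \<open>V \<times> V\<^sup>*\<close> differ by \<open>h(v)\<close> and are annihilated by \<open>p\<close> and \<open>q\<close>.

  All differences of a root of \<open>p\<close> and a root of \<open>q\<close> have the same minimal polynomial, and it is a
  polynomial in \<open>s = t\<^sup>2 - (l - m) t\<close>; this is where the assumption on the characteristic enters. So
  \<open>V\<close> is a direct sum of cyclic modules \<open>F[t]/(r(s)) = U \<oplus> t U\<close> with \<open>U = F[s]/(r)\<close>, and on each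
  summand \<open>D (x + t y) = (s + \<beta> - \<alpha>) y + l t y\<close> will do, with \<open>N\<close> the symplectic form on \<open>U \<oplus> t U\<close>
  obtained from a nondegenerate symmetric form on \<open>U\<close> for which \<open>s\<close> is self-adjoint.
\<close>

section \<open>Polynomials in an endomorphism\<close>

text \<open>Instantiated twice: for \<open>v\<close> itself, and over the algebraic closure for the
  matrix of \<open>v\<close> acting on functions.\<close>

locale vector_space_endo = vector_space scale
  for scale :: "'a::field \<Rightarrow> 'v::ab_group_add \<Rightarrow> 'v" +
  fixes v :: "'v \<Rightarrow> 'v"
  assumes linear_v: "Vector_Spaces.linear scale scale v"
begin

abbreviation ev :: "'a poly \<Rightarrow> 'v \<Rightarrow> 'v" where
  "ev f \<equiv> poly_endo scale f v"

lemma v_add: "v (x + y) = v x + v y"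
  using linear_v by (simp add: Vector_Spaces.linear_iff)

lemma v_scale: "v (scale a x) = scale a (v x)"
  using linear_v by (simp add: Vector_Spaces.linear_iff)

lemma v_0 [simp]: "v 0 = 0"
  using v_scale[of 0 0] by simp

lemma v_sum: "v (sum g A) = (\<Sum>i\<in>A. v (g i))"
  by (induction A rule: infinite_finite_induct) (simp_all add: v_add)

lemma ev_alt:
  assumes "Polynomial.degree f \<le> n"
  shows "ev f x = (\<Sum>i\<le>n. scale (Polynomial.coeff f i) ((v ^^ i) x))"
proof -
  have "(\<Sum>i\<le>Polynomial.degree f. scale (Polynomial.coeff f i) ((v ^^ i) x)) =
      (\<Sum>i\<le>n. scale (Polynomial.coeff f i) ((v ^^ i) x))"
    using assms by (intro sum.mono_neutral_left) (auto intro: coeff_eq_0)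
  then show ?thesis by (simp add: poly_endo_def)
qed

lemma ev_0 [simp]: "ev 0 x = 0"
  by (simp add: poly_endo_def)

text \<open>Horner's rule, the recursion from which the \<open>F[t]\<close>-module laws below follow
  by induction on the polynomial.\<close>

lemma ev_pCons: "ev (pCons a f) x = scale a x + v (ev f x)"
proof -
  let ?n = "Polynomial.degree f"
  \<comment> \<open>The bound \<open>Suc ?n\<close> exceeds the degree when \<open>f = 0\<close>;
    the extra coefficient is then 0.\<close>
  have "ev (pCons a f) x = (\<Sum>i\<le>Suc ?n. scale (Polynomial.coeff (pCons a f) i) ((v ^^ i) x))"
    by (rule ev_alt) (rule degree_pCons_le)
  also have "\<dots> = scale a x + (\<Sum>i\<le>?n. scale (Polynomial.coeff f i) ((v ^^ Suc i) x))"
    by (simp only: sum.atMost_Suc_shift) simp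
  also have "\<dots> = scale a x + v (ev f x)"
    by (simp add: poly_endo_def v_sum v_scale)
  finally show ?thesis .
qed

lemma ev_const: "ev [:a:] x = scale a x"
  by (simp add: ev_pCons)

lemma ev_1 [simp]: "ev 1 x = x"
  by (simp add: one_pCons ev_const)

lemma ev_add: "ev (f + g) x = ev f x + ev g x"
  by (induction f g rule: poly_induct2) (simp_all add: ev_pCons v_add scale_left_distrib)

lemma ev_smult: "ev (smult a f) x = scale a (ev f x)"
  by (induction f) (simp_all add: ev_pCons v_scale scale_right_distrib)

lemma ev_uminus: "ev (- f) x = - ev f x"
  using ev_smult[of "-1" f x] by simp

lemma ev_diff: "ev (f - g) x = ev f x - ev g x"
  using ev_add[of f "- g" x] by (simp add: ev_uminus)

lemma ev_mult: "ev (f * g) x = ev f (ev g x)"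
  by (induction f) (simp_all add: ev_pCons ev_add ev_smult)

lemma ev_commute: "ev f (ev g x) = ev g (ev f x)"
  by (metis ev_mult mult.commute)

lemma ev_arg_add: "ev f (x + y) = ev f x + ev f y"
  by (induction f) (simp_all add: ev_pCons v_add scale_right_distrib)

lemma ev_arg_scale: "ev f (scale a x) = scale a (ev f x)"
  by (induction f) (simp_all add: ev_pCons v_add v_scale scale_right_distrib)

lemma ev_arg_0 [simp]: "ev f 0 = 0"
  using ev_arg_scale[of f 0 0] by simp

lemma ev_X: "ev [:0, 1:] x = v x"
  by (simp add: ev_pCons)

lemma ev_monom: "ev (Polynomial.monom 1 i) x = (v ^^ i) x"
  by (induction i) (simp_all add: monom_Suc ev_pCons monom_0 ev_const)

lemma ev_dvd: "f dvd g \<Longrightarrow> ev f x = 0 \<Longrightarrow> ev g x = 0"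
  by (metis dvd_def ev_mult ev_arg_0 mult.commute)

end

section \<open>Splitting an endomorphism along a symplectic form\<close>

text \<open>The second clause makes \<open>l - D\<close> the \<open>N\<close>-adjoint of
  \<open>D\<close>, the third makes \<open>t^2 - l t + k\<close> annihilate \<open>D\<close>. So
  \<open>D\<close> composed with its adjoint is multiplication by \<open>k\<close>.\<close>

definition quadratic_adjoint ::
    "('a::field \<Rightarrow> 'v::ab_group_add \<Rightarrow> 'v) \<Rightarrow> 'v set \<Rightarrow> ('v \<Rightarrow> 'v \<Rightarrow> 'a) \<Rightarrow> 'a \<Rightarrow> 'a \<Rightarrow> ('v \<Rightarrow> 'v) \<Rightarrow> bool" where
  "quadratic_adjoint scale S N l k D \<longleftrightarrow>
     endomorphism_on scale S D \<and>
     (\<forall>x\<in>S. \<forall>y\<in>S. N (D x) y + N x (D y) = l * N x y) \<and>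
     (\<forall>x\<in>S. D (D x) = scale l (D x) - scale k x)"

text \<open>The constants \<open>0\<close> and \<open>k\<close> are those of \<open>p\<close> and
  \<open>q\<close> lowered by \<open>\<alpha>\<close>, so that \<open>k\<close> stands for
  \<open>\<beta> - \<alpha>\<close>; the block matrices put \<open>\<alpha>\<close> back. The set
  \<open>S\<close> is explicit so that splittings of invariant subspaces can be glued.\<close>

definition splits ::
    "('a::field \<Rightarrow> 'v::ab_group_add \<Rightarrow> 'v) \<Rightarrow> 'a \<Rightarrow> 'a \<Rightarrow> 'a \<Rightarrow> ('v \<Rightarrow> 'v) \<Rightarrow> 'v set \<Rightarrow> bool" where
  "splits scale l m k v S \<longleftrightarrow>
     (\<exists>N D E. symplectic_form scale S N \<and> quadratic_adjoint scale S N l 0 D \<and>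
        quadratic_adjoint scale S N m k E \<and> (\<forall>x\<in>S. v x = D x - E x))"

context vector_space
begin

lemma splits_zero: "splits scale l m k v {0}" if "v 0 = 0"
  unfolding splits_def
  by (rule exI[of _ "\<lambda>_ _. 0"], rule exI[of _ "\<lambda>_. 0"], rule exI[of _ "\<lambda>_. 0"])
     (simp add: that symplectic_form_def bilinear_on_def quadratic_adjoint_def endomorphism_on_def)

text \<open>Make the two summands orthogonal: the new form and operators act through the projections
  \<open>P\<close> onto \<open>S\<close> and \<open>Q\<close> onto \<open>T\<close>, and each
  required identity holds componentwise.\<close>

lemma splits_sum:
  assumes S: "subspace S" and T: "subspace T" and ST: "S \<inter> T = {0}"
    and "splits scale l m k v S" and "splits scale l m k v T"
    and v: "Vector_Spaces.linear scale scale v"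
  shows "splits scale l m k v {x + y |x y. x \<in> S \<and> y \<in> T}"
proof -
  let ?Z = "{x + y |x y. x \<in> S \<and> y \<in> T}"
  define P where "P z = (SOME x. x \<in> S \<and> z - x \<in> T)" for z
  define Q where "Q z = z - P z" for z
  have uniq: "x = x' \<and> y = y'"
    if "x \<in> S" "x' \<in> S" "y \<in> T" "y' \<in> T" "x + y = x' + y'" for x x' y y'
  proof -
    have "x - x' = y' - y" using that by (simp add: algebra_simps)
    moreover have "x - x' \<in> S" "y' - y \<in> T"
      using that S T by (auto intro: subspace_diff)
    ultimately have "x - x' \<in> S \<inter> T" by simp
    with ST have "x = x'" by auto
    with that show ?thesis by simp
  qed
  have PS: "P z \<in> S" and QT: "Q z \<in> T" if "z \<in> ?Z" for z
  proof -
    from that obtain x y where "z = x + y" "x \<in> S" "y \<in> T" by blast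
    then have "\<exists>x. x \<in> S \<and> z - x \<in> T" by (intro exI[of _ x]) simp
    then have "P z \<in> S \<and> z - P z \<in> T" unfolding P_def by (rule someI_ex)
    then show "P z \<in> S" "Q z \<in> T" by (simp_all add: Q_def)
  qed
  have PQ: "P (x + y) = x" "Q (x + y) = y" if "x \<in> S" "y \<in> T" for x y
  proof -
    have "x + y \<in> ?Z" using that by blast
    from uniq[OF PS[OF this] that(1) QT[OF this] that(2)]
    show "P (x + y) = x" "Q (x + y) = y" by (simp_all add: Q_def)
  qed
  have PQ_add: "P (z + w) = P z + P w" "Q (z + w) = Q z + Q w" if "z \<in> ?Z" "w \<in> ?Z" for z w
  proof -
    have "z + w = (P z + P w) + (Q z + Q w)" by (simp add: Q_def)
    then show "P (z + w) = P z + P w" "Q (z + w) = Q z + Q w"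
      using PQ[of "P z + P w" "Q z + Q w"] PS QT that S T by (simp_all add: subspace_add)
  qed
  have PQ_scale: "P (scale a z) = scale a (P z)" "Q (scale a z) = scale a (Q z)"
    if "z \<in> ?Z" for a z
  proof -
    have "scale a z = scale a (P z) + scale a (Q z)" by (simp add: Q_def scale_right_diff_distrib)
    then show "P (scale a z) = scale a (P z)" "Q (scale a z) = scale a (Q z)"
      using PQ[of "scale a (P z)" "scale a (Q z)"] PS QT that S T by (simp_all add: subspace_scale)
  qed
  obtain N1 D1 E1 where 1: "symplectic_form scale S N1" "quadratic_adjoint scale S N1 l 0 D1"
      "quadratic_adjoint scale S N1 m k E1" "\<forall>x\<in>S. v x = D1 x - E1 x"
    using assms(4) unfolding splits_def by blast
  obtain N2 D2 E2 where 2: "symplectic_form scale T N2" "quadratic_adjoint scale T N2 l 0 D2"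
      "quadratic_adjoint scale T N2 m k E2" "\<forall>x\<in>T. v x = D2 x - E2 x"
    using assms(5) unfolding splits_def by blast
  define N where "N z w = N1 (P z) (P w) + N2 (Q z) (Q w)" for z w
  have 0: "0 \<in> S" "0 \<in> T" using S T by (simp_all add: subspace_0)
  have inZ: "x + y \<in> ?Z" if "x \<in> S" "y \<in> T" for x y
    using that by blast
  have b1: "N1 0 x = 0" "N1 x 0 = 0" if "x \<in> S" for x
  proof -
    have "N1 (scale 0 x) x = 0 * N1 x x" "N1 x (scale 0 x) = 0 * N1 x x"
      using 1(1) that unfolding symplectic_form_def bilinear_on_def by blast+
    then show "N1 0 x = 0" "N1 x 0 = 0" by simp_all
  qed
  have b2: "N2 0 x = 0" "N2 x 0 = 0" if "x \<in> T" for x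
  proof -
    have "N2 (scale 0 x) x = 0 * N2 x x" "N2 x (scale 0 x) = 0 * N2 x x"
      using 2(1) that unfolding symplectic_form_def bilinear_on_def by blast+
    then show "N2 0 x = 0" "N2 x 0 = 0" by simp_all
  qed
  have "symplectic_form scale ?Z N"
    unfolding symplectic_form_def
  proof (intro conjI ballI impI)
    have "bilinear_on scale S N1" "bilinear_on scale T N2"
      using 1(1) 2(1) by (simp_all add: symplectic_form_def)
    then show "bilinear_on scale ?Z N"
      unfolding bilinear_on_def N_def
      by (intro conjI ballI allI) (simp_all add: PS QT PQ_add PQ_scale algebra_simps)
  next
    fix z assume "z \<in> ?Z"
    then show "N z z = 0"
      using 1(1) 2(1) PS QT by (simp add: N_def symplectic_form_def)
  next
    fix z assume z: "z \<in> ?Z" and *: "\<forall>w\<in>?Z. N z w = 0"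
    have "N1 (P z) x = 0" if "x \<in> S" for x
      using *[rule_format, OF inZ[OF that 0(2)]] PQ[OF that 0(2)] QT[OF z]
      by (simp add: N_def b2)
    then have "P z = 0" using 1(1) PS[OF z] by (simp add: symplectic_form_def)
    moreover have "N2 (Q z) y = 0" if "y \<in> T" for y
      using *[rule_format, OF inZ[OF 0(1) that]] PQ[OF 0(1) that] PS[OF z]
      by (simp add: N_def b1)
    then have "Q z = 0" using 2(1) QT[OF z] by (simp add: symplectic_form_def)
    ultimately show "z = 0" by (simp add: Q_def)
  qed
  \<comment> \<open>One claim for both operators: it is used with \<open>l\<close>, \<open>0\<close>
    for \<open>D\<close> and with \<open>m\<close>, \<open>k\<close> for \<open>E\<close>.\<close>
  moreover have "quadratic_adjoint scale ?Z N l' k' (\<lambda>z. D1' (P z) + D2' (Q z))"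
    if d: "quadratic_adjoint scale S N1 l' k' D1'" "quadratic_adjoint scale T N2 l' k' D2'"
    for l' k' D1' D2'
  proof -
    have DX: "D1' x \<in> S" if "x \<in> S" for x
      using d(1) that by (simp add: quadratic_adjoint_def endomorphism_on_def)
    have DY: "D2' y \<in> T" if "y \<in> T" for y
      using d(2) that by (simp add: quadratic_adjoint_def endomorphism_on_def)
    show ?thesis
      unfolding quadratic_adjoint_def
    proof (intro conjI ballI)
      show "endomorphism_on scale ?Z (\<lambda>z. D1' (P z) + D2' (Q z))"
        unfolding endomorphism_on_def
      proof (intro conjI ballI allI)
        fix z assume "z \<in> ?Z"
        then show "D1' (P z) + D2' (Q z) \<in> ?Z" using PS QT DX DY by blast
      next
        fix z w assume "z \<in> ?Z" "w \<in> ?Z"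
        then show "D1' (P (z + w)) + D2' (Q (z + w)) =
            D1' (P z) + D2' (Q z) + (D1' (P w) + D2' (Q w))"
          using d by (simp add: quadratic_adjoint_def endomorphism_on_def PQ_add PS QT)
      next
        fix z a assume "z \<in> ?Z"
        then show "D1' (P (scale a z)) + D2' (Q (scale a z)) = scale a (D1' (P z) + D2' (Q z))"
          using d by (simp add: quadratic_adjoint_def endomorphism_on_def PQ_scale PS QT
              scale_right_distrib)
      qed
    next
      fix z w assume zw: "z \<in> ?Z" "w \<in> ?Z"
      have "N1 (D1' (P z)) (P w) + N1 (P z) (D1' (P w)) = l' * N1 (P z) (P w)"
        "N2 (D2' (Q z)) (Q w) + N2 (Q z) (D2' (Q w)) = l' * N2 (Q z) (Q w)"
        using d zw PS QT by (simp_all add: quadratic_adjoint_def)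
      then show "N (D1' (P z) + D2' (Q z)) w + N z (D1' (P w) + D2' (Q w)) = l' * N z w"
        using zw by (simp add: N_def PQ DX DY PS QT algebra_simps)
    next
      fix z assume z: "z \<in> ?Z"
      have "D1' (D1' (P z)) = scale l' (D1' (P z)) - scale k' (P z)"
        "D2' (D2' (Q z)) = scale l' (D2' (Q z)) - scale k' (Q z)"
        using d z PS QT by (simp_all add: quadratic_adjoint_def)
      moreover have "scale k' z = scale k' (P z) + scale k' (Q z)"
        by (simp add: Q_def scale_right_diff_distrib)
      ultimately show "D1' (P (D1' (P z) + D2' (Q z))) + D2' (Q (D1' (P z) + D2' (Q z))) =
          scale l' (D1' (P z) + D2' (Q z)) - scale k' z"
        using z by (simp add: PQ DX DY PS QT scale_right_distrib)
    qed
  qed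
  moreover have "v z = D1 (P z) + D2 (Q z) - (E1 (P z) + E2 (Q z))" if "z \<in> ?Z" for z
  proof -
    have "v z = v (P z) + v (Q z)"
      using v by (metis Q_def add.commute diff_add_cancel Vector_Spaces.linear_iff)
    then show ?thesis using 1(4) 2(4) PS QT that by simp
  qed
  ultimately show ?thesis
    unfolding splits_def using 1 2 by blast
qed

end

section \<open>Cyclic endomorphisms\<close>

context vector_space
begin

text \<open>
  In the application, \<open>enc f0 f1 = f0(c) x + v (f1(c) x)\<close> with \<open>c = v\<^sup>2 - (l - m) v\<close>. The form \<open>N\<close> is
  built from the functional \<open>\<tau>\<close> that reads off the top coefficient modulo \<open>r\<close>.
\<close>

lemma splits_pairs:
  fixes enc :: "'a poly \<Rightarrow> 'a poly \<Rightarrow> 'b" and r :: "'a poly"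
  assumes r: "0 < Polynomial.degree r"
    and enc_add: "\<And>f0 f1 g0 g1. enc (f0 + g0) (f1 + g1) = enc f0 f1 + enc g0 g1"
    and enc_smult: "\<And>a f0 f1. enc (Polynomial.smult a f0) (Polynomial.smult a f1) = scale a (enc f0 f1)"
    and enc_0: "\<And>f0 f1. enc f0 f1 = 0 \<longleftrightarrow> r dvd f0 \<and> r dvd f1"
    and v: "\<And>f0 f1. v (enc f0 f1) = enc ([:0, 1:] * f1) (f0 + Polynomial.smult (l - m) f1)"
  shows "splits scale l m k v {enc f0 f1 |f0 f1. True}"
proof -
  let ?S = "{enc f0 f1 |f0 f1. True}"
  let ?n = "Polynomial.degree r"
  define \<tau> where "\<tau> f = Polynomial.coeff (f mod r) (?n - 1)" for f :: "'a poly"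
  have \<tau>_add: "\<tau> (f + g) = \<tau> f + \<tau> g" for f g
    by (simp add: \<tau>_def poly_mod_add_left)
  have \<tau>_smult: "\<tau> (Polynomial.smult a f) = a * \<tau> f" for a f
    by (simp add: \<tau>_def mod_smult_left)
  have \<tau>_diff: "\<tau> (f - g) = \<tau> f - \<tau> g" for f g
    by (simp add: \<tau>_def poly_mod_diff_left)
  have \<tau>_cong: "\<tau> f = \<tau> g" if "r dvd f - g" for f g
  proof -
    from that obtain h where "f = g + r * h" by (metis dvdE add.commute diff_add_cancel)
    then show ?thesis by (simp add: \<tau>_def)
  qed
  \<comment> \<open>To detect a nonzero remainder \<open>g\<close>, multiply it by the power of
    \<open>t\<close> that raises its degree to \<open>?n - 1\<close>; there \<open>\<tau>\<close>
    reads off the leading coefficient.\<close>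
  have \<tau>_nondeg: "r dvd f" if *: "\<And>h. \<tau> (f * h) = 0" for f
  proof (rule ccontr)
    assume "\<not> r dvd f"
    define g where "g = f mod r"
    have g: "g \<noteq> 0" using \<open>\<not> r dvd f\<close> by (simp add: g_def mod_eq_0_iff_dvd)
    have gn: "Polynomial.degree g < ?n"
      using r g unfolding g_def by (intro degree_mod_less_degree) (auto simp: mod_eq_0_iff_dvd)
    define h where "h = Polynomial.monom (1::'a) (?n - 1 - Polynomial.degree g)"
    have h: "h \<noteq> 0" "Polynomial.degree h = ?n - 1 - Polynomial.degree g"
      by (simp_all add: h_def Polynomial.degree_monom_eq)
    have dgh: "Polynomial.degree (g * h) = ?n - 1"
      using g h gn by (simp add: Polynomial.degree_mult_eq)
    have "f * h mod r = g * h mod r"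
      by (simp add: g_def mod_mult_left_eq)
    also have "\<dots> = g * h"
      using dgh r by (intro mod_poly_less) linarith
    finally have "\<tau> (f * h) = lead_coeff (g * h)"
      by (simp add: \<tau>_def dgh)
    with * g h show False by (metis leading_coeff_0_iff mult_eq_0_iff)
  qed
  have enc_eq: "enc f0 f1 = enc g0 g1 \<longleftrightarrow> r dvd f0 - g0 \<and> r dvd f1 - g1" for f0 f1 g0 g1
    using enc_add[of "f0 - g0" g0 "f1 - g1" g1] enc_0[of "f0 - g0" "f1 - g1"] by auto
  \<comment> \<open>Arbitrary representatives of the two coordinates of \<open>x\<close> modulo
    \<open>r\<close>. The choice does not affect \<open>N\<close>, \<open>D\<close> and
    \<open>E\<close> below, since \<open>\<tau>\<close> and \<open>enc\<close> only see classes
    modulo \<open>r\<close>.\<close>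
  define a0 where "a0 x = fst (SOME w. x = enc (fst w) (snd w))" for x
  define a1 where "a1 x = snd (SOME w. x = enc (fst w) (snd w))" for x
  have a: "enc (a0 (enc f0 f1)) (a1 (enc f0 f1)) = enc f0 f1" for f0 f1
  proof -
    have "\<exists>w. enc f0 f1 = enc (fst w) (snd w)" by (rule exI[of _ "(f0, f1)"]) simp
    from someI_ex[OF this] show ?thesis by (simp add: a0_def a1_def)
  qed
  then have a_dvd: "r dvd a0 (enc f0 f1) - f0" "r dvd a1 (enc f0 f1) - f1" for f0 f1
    by (simp_all add: enc_eq)
  \<comment> \<open>Up to sign, \<open>\<tau>\<close> of the determinant of the two coordinate
    columns. For such a form the adjoint of a 2 x 2 matrix over \<open>F[s]/(r)\<close> is its
    adjugate, that is, its trace minus the matrix.\<close>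
  define N where "N x y = \<tau> (a1 x * a0 y - a0 x * a1 y)" for x y
  have N: "N (enc f0 f1) (enc g0 g1) = \<tau> (f1 * g0 - f0 * g1)" for f0 f1 g0 g1
    unfolding N_def
  proof (rule \<tau>_cong)
    let ?x = "enc f0 f1" and ?y = "enc g0 g1"
    have "a1 ?x * a0 ?y - a0 ?x * a1 ?y - (f1 * g0 - f0 * g1) =
        (a1 ?x - f1) * a0 ?y + f1 * (a0 ?y - g0) - ((a0 ?x - f0) * a1 ?y + f0 * (a1 ?y - g1))"
      by (simp add: algebra_simps)
    also have "r dvd \<dots>"
      by (intro dvd_diff dvd_add dvd_mult dvd_mult2 a_dvd)
    finally show "r dvd a1 ?x * a0 ?y - a0 ?x * a1 ?y - (f1 * g0 - f0 * g1)" .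
  qed
  \<comment> \<open>On coordinate columns \<open>D\<close> is the matrix with rows
    \<open>(0, s + k)\<close> and \<open>(0, l)\<close>, of trace \<open>l\<close> and determinant
    \<open>0\<close>. Cayley-Hamilton is the quadratic equation wanted for it.\<close>
  define D where "D x = enc ([:k, 1:] * a1 x) (Polynomial.smult l (a1 x))" for x
  have D: "D (enc f0 f1) = enc ([:k, 1:] * f1) (Polynomial.smult l f1)" for f0 f1
    unfolding D_def enc_eq by (metis a_dvd(2) dvd_mult dvd_smult right_diff_distrib smult_diff_right)
  \<comment> \<open>Forced by \<open>E = D - v\<close>: the matrix has rows \<open>(0, k)\<close>
    and \<open>(-1, m)\<close>, with trace \<open>m\<close> and determinant
    \<open>k\<close>.\<close>
  define E where "E x = enc (Polynomial.smult k (a1 x)) (Polynomial.smult m (a1 x) - a0 x)" for x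
  have E: "E (enc f0 f1) = enc (Polynomial.smult k f1) (Polynomial.smult m f1 - f0)" for f0 f1
    unfolding E_def enc_eq
  proof
    let ?x = "enc f0 f1"
    have "Polynomial.smult k (a1 ?x) - Polynomial.smult k f1 = Polynomial.smult k (a1 ?x - f1)"
      "Polynomial.smult m (a1 ?x) - a0 ?x - (Polynomial.smult m f1 - f0) =
        Polynomial.smult m (a1 ?x - f1) - (a0 ?x - f0)"
      by (simp_all add: smult_diff_right)
    then show "r dvd Polynomial.smult k (a1 ?x) - Polynomial.smult k f1"
      "r dvd Polynomial.smult m (a1 ?x) - a0 ?x - (Polynomial.smult m f1 - f0)"
      by (metis a_dvd dvd_smult dvd_diff)+
  qed
  have enc_diff: "enc f0 f1 - enc g0 g1 = enc (f0 - g0) (f1 - g1)" for f0 f1 g0 g1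
    using enc_add[of "f0 - g0" g0 "f1 - g1" g1] by simp
  note encs = enc_add[symmetric] enc_smult[symmetric] enc_diff N D E
  have "symplectic_form scale ?S N"
    unfolding symplectic_form_def
  proof (intro conjI ballI impI)
    show "bilinear_on scale ?S N"
      unfolding bilinear_on_def
      by (auto simp: encs \<tau>_diff \<tau>_add \<tau>_smult algebra_simps)
  next
    fix x assume "x \<in> ?S"
    then show "N x x = 0" by (auto simp: N mult.commute \<tau>_def)
  next
    fix x assume "x \<in> ?S" and *: "\<forall>y\<in>?S. N x y = 0"
    then obtain f0 f1 where x: "x = enc f0 f1" by blast
    have "\<tau> (f1 * h) = 0" for h
    proof -
      have "N x (enc h 0) = 0" using * by blast
      then show ?thesis by (simp add: x N)
    qed
    moreover have "\<tau> (f0 * h) = 0" for h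
    proof -
      have "N x (enc 0 (- h)) = 0" using * by blast
      then show ?thesis by (simp add: x N)
    qed
    ultimately show "x = 0" unfolding x enc_0 using \<tau>_nondeg by blast
  qed
  moreover have "quadratic_adjoint scale ?S N l 0 D"
    unfolding quadratic_adjoint_def endomorphism_on_def
  proof (intro conjI ballI allI)
    fix x assume "x \<in> ?S"
    then obtain f0 f1 where "x = enc f0 f1" by blast
    then show "D x \<in> ?S" unfolding \<open>x = enc f0 f1\<close> D by blast
  next
    fix x y assume "x \<in> ?S" "y \<in> ?S"
    then obtain f0 f1 g0 g1 where xy: "x = enc f0 f1" "y = enc g0 g1" by blast
    show "D (x + y) = D x + D y"
      by (simp only: xy encs smult_add_right ring_distribs)
    show "N (D x) y + N x (D y) = l * N x y"
      by (simp add: xy encs \<tau>_diff \<tau>_add \<tau>_smult algebra_simps)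
  next
    fix a x assume "x \<in> ?S"
    then obtain f0 f1 where x: "x = enc f0 f1" by blast
    show "D (scale a x) = scale a (D x)"
      by (simp add: x encs smult_add_right mult.commute)
  next
    fix x assume "x \<in> ?S"
    then obtain f0 f1 where x: "x = enc f0 f1" by blast
    show "D (D x) = scale l (D x) - scale 0 x"
      by (simp add: x encs smult_add_right mult.commute)
  qed
  moreover have "quadratic_adjoint scale ?S N m k E"
    unfolding quadratic_adjoint_def endomorphism_on_def
  proof (intro conjI ballI allI)
    fix x assume "x \<in> ?S"
    then obtain f0 f1 where "x = enc f0 f1" by blast
    then show "E x \<in> ?S" unfolding \<open>x = enc f0 f1\<close> E by blast
  next
    fix x y assume "x \<in> ?S" "y \<in> ?S"
    then obtain f0 f1 g0 g1 where xy: "x = enc f0 f1" "y = enc g0 g1" by blast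
    show "E (x + y) = E x + E y"
      by (simp add: xy encs smult_add_right algebra_simps)
    show "N (E x) y + N x (E y) = m * N x y"
      by (simp add: xy encs \<tau>_diff \<tau>_add \<tau>_smult algebra_simps)
  next
    fix a x assume "x \<in> ?S"
    then obtain f0 f1 where x: "x = enc f0 f1" by blast
    show "E (scale a x) = scale a (E x)"
      by (simp add: x encs smult_diff_right mult.commute)
  next
    fix x assume "x \<in> ?S"
    then obtain f0 f1 where x: "x = enc f0 f1" by blast
    show "E (E x) = scale m (E x) - scale k x"
      by (simp add: x encs smult_diff_right mult.commute)
  qed
  moreover have "\<forall>x\<in>?S. v x = D x - E x"
    by (auto simp: encs v smult_diff_left algebra_simps)
  ultimately show ?thesis
    unfolding splits_def by blast
qed

end

section \<open>Coordinates \<open>f0(s) + t f1(s)\<close> of a polynomial with respect to a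
  quadratic \<open>s\<close>\<close>

lemma even_odd_pcompose:
  fixes f0 f1 s :: "'a::field poly"
  assumes s: "Polynomial.degree s = 2" and "f0 \<circ>\<^sub>p s + [:0, 1:] * (f1 \<circ>\<^sub>p s) = 0"
  shows "f0 = 0 \<and> f1 = 0"
proof -
  have *: "f0 \<circ>\<^sub>p s = - ([:0, 1:] * (f1 \<circ>\<^sub>p s))"
    using assms(2) by (simp only: eq_neg_iff_add_eq_0)
  have "f1 = 0"
  proof (rule ccontr)
    assume "f1 \<noteq> 0"
    then have "f1 \<circ>\<^sub>p s \<noteq> 0" using s pcompose_eq_0[of f1 s] by auto
    then have "Polynomial.degree ([:0, 1:] * (f1 \<circ>\<^sub>p s)) = 1 + Polynomial.degree f1 * 2"
      by (subst Polynomial.degree_mult_eq) (simp_all add: Polynomial.degree_pcompose s)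
    moreover have "Polynomial.degree (f0 \<circ>\<^sub>p s) = Polynomial.degree f0 * 2"
      by (simp add: Polynomial.degree_pcompose s)
    \<comment> \<open>One side of \<open>*\<close> has even degree and the other odd degree.\<close>
    ultimately show False using arg_cong[OF *, of Polynomial.degree] by (simp only: Polynomial.degree_minus) presburger
  qed
  moreover from this have "f0 \<circ>\<^sub>p s = 0" using * by simp
  then have "f0 = 0" using s pcompose_eq_0[of f0 s] by auto
  ultimately show ?thesis by simp
qed

text \<open>Modulo \<open>r(s)\<close> both coordinates may be reduced modulo \<open>r\<close>. The
  result has degree below that of \<open>r(s)\<close>, so divisibility forces it to vanish, and then
  both remainders are 0 by uniqueness of the coordinates.\<close>

lemma even_odd_pcompose_dvd:
  fixes f0 f1 r s :: "'a::field poly"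
  assumes s: "Polynomial.degree s = 2" and r: "0 < Polynomial.degree r"
  shows "r \<circ>\<^sub>p s dvd f0 \<circ>\<^sub>p s + [:0, 1:] * (f1 \<circ>\<^sub>p s) \<longleftrightarrow> r dvd f0 \<and> r dvd f1"
proof
  assume *: "r \<circ>\<^sub>p s dvd f0 \<circ>\<^sub>p s + [:0, 1:] * (f1 \<circ>\<^sub>p s)"
  define g0 where "g0 = f0 mod r"
  define g1 where "g1 = f1 mod r"
  have f: "f0 = g0 + r * (f0 div r)" "f1 = g1 + r * (f1 div r)"
    by (simp_all add: g0_def g1_def)
  have "f0 \<circ>\<^sub>p s + [:0, 1:] * (f1 \<circ>\<^sub>p s) = (g0 \<circ>\<^sub>p s + [:0, 1:] * (g1 \<circ>\<^sub>p s)) +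
      (r \<circ>\<^sub>p s) * ((f0 div r) \<circ>\<^sub>p s + [:0, 1:] * ((f1 div r) \<circ>\<^sub>p s))"
    by (subst f(1), subst f(2)) (simp only: pcompose_add pcompose_mult ring_distribs ac_simps)
  with * have "r \<circ>\<^sub>p s dvd g0 \<circ>\<^sub>p s + [:0, 1:] * (g1 \<circ>\<^sub>p s)"
    by (metis dvd_add_left_iff dvd_triv_left)
  moreover have "Polynomial.degree (g0 \<circ>\<^sub>p s + [:0, 1:] * (g1 \<circ>\<^sub>p s)) < Polynomial.degree (r \<circ>\<^sub>p s)"
  proof -
    have "r \<noteq> 0" using r by auto
    then have "Polynomial.degree g0 < Polynomial.degree r" "Polynomial.degree g1 < Polynomial.degree r"
      using degree_mod_less[of r f0] degree_mod_less[of r f1] r unfolding g0_def g1_def by auto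
    moreover have "Polynomial.degree ([:0, 1:] * (g1 \<circ>\<^sub>p s)) \<le> 1 + Polynomial.degree g1 * 2"
      using Polynomial.degree_mult_le[of "[:0, 1:]" "g1 \<circ>\<^sub>p s"] by (simp add: Polynomial.degree_pcompose s)
    ultimately show ?thesis
      by (intro Polynomial.degree_add_less) (simp_all add: Polynomial.degree_pcompose s)
  qed
  ultimately have "g0 \<circ>\<^sub>p s + [:0, 1:] * (g1 \<circ>\<^sub>p s) = 0"
    by (meson dvd_imp_degree_le linorder_not_less)
  from even_odd_pcompose[OF s this] show "r dvd f0 \<and> r dvd f1"
    by (simp add: g0_def g1_def mod_eq_0_iff_dvd)
next
  assume "r dvd f0 \<and> r dvd f1"
  then show "r \<circ>\<^sub>p s dvd f0 \<circ>\<^sub>p s + [:0, 1:] * (f1 \<circ>\<^sub>p s)"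
    by (auto elim!: dvdE simp only: pcompose_mult intro!: dvd_add dvd_mult dvd_triv_left)
qed

text \<open>Since \<open>t^2 = s + d t\<close>, multiplication by \<open>t\<close> takes the
  coordinates \<open>(f0, f1)\<close> to \<open>(s f1, f0 + d f1)\<close>.\<close>

lemma even_odd_pcompose_exists:
  fixes f :: "'a::field poly"
  shows "\<exists>f0 f1. f = f0 \<circ>\<^sub>p [:0, - d, 1:] + [:0, 1:] * (f1 \<circ>\<^sub>p [:0, - d, 1:])"
proof (induction f)
  case 0
  show ?case by (intro exI[of _ 0]) simp
next
  case (pCons a f)
  let ?s = "[:0, - d, 1:]"
  from pCons obtain f0 f1 where f: "f = f0 \<circ>\<^sub>p ?s + [:0, 1:] * (f1 \<circ>\<^sub>p ?s)" by blast
  have sq: "[:0, 1:] * [:0, 1:] = ?s + Polynomial.smult d [:0, 1:]" by simp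
  have "pCons a f = [:a:] + [:0, 1:] * f" by simp
  also have "\<dots> = [:a:] + [:0, 1:] * (f0 \<circ>\<^sub>p ?s) + ([:0, 1:] * [:0, 1:]) * (f1 \<circ>\<^sub>p ?s)"
    by (subst f) (simp only: ring_distribs mult.assoc add.assoc)
  also have "\<dots> = (pCons a f1) \<circ>\<^sub>p ?s + [:0, 1:] * ((f0 + Polynomial.smult d f1) \<circ>\<^sub>p ?s)"
    unfolding sq pcompose_pCons[of a f1] pcompose_add pcompose_smult
    by (simp only: ring_distribs mult_smult_left mult_smult_right ac_simps)
  finally show ?case by blast
qed

context vector_space_endo
begin

text \<open>By \<open>ann\<close> the cyclic submodule is \<open>F[t]/(r(s))\<close> with
  \<open>s = t^2 - (l - m) t\<close>. Its coordinates \<open>(f0, f1)\<close> are the input of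
  \<open>splits_pairs\<close>, as \<open>v\<close> acts by multiplication by
  \<open>t\<close>.\<close>

lemma splits_cyclic:
  assumes r: "0 < Polynomial.degree r"
    and ann: "\<And>f. ev f x = 0 \<longleftrightarrow> r \<circ>\<^sub>p [:0, - (l - m), 1:] dvd f"
  shows "splits scale l m k v (range (\<lambda>f. ev f x))"
proof -
  let ?s = "[:0, - (l - m), 1:]"
  define enc where "enc f0 f1 = ev (f0 \<circ>\<^sub>p ?s + [:0, 1:] * (f1 \<circ>\<^sub>p ?s)) x" for f0 f1
  have "splits scale l m k v {enc f0 f1 |f0 f1. True}"
  proof (rule splits_pairs[OF r])
    fix f0 f1 g0 g1
    have eq: "(f0 + g0) \<circ>\<^sub>p ?s + [:0, 1:] * ((f1 + g1) \<circ>\<^sub>p ?s) =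
        (f0 \<circ>\<^sub>p ?s + [:0, 1:] * (f1 \<circ>\<^sub>p ?s)) + (g0 \<circ>\<^sub>p ?s + [:0, 1:] * (g1 \<circ>\<^sub>p ?s))"
      by (simp only: pcompose_add ring_distribs ac_simps)
    show "enc (f0 + g0) (f1 + g1) = enc f0 f1 + enc g0 g1"
      unfolding enc_def eq by (rule ev_add)
  next
    fix a f0 f1
    have eq: "Polynomial.smult a f0 \<circ>\<^sub>p ?s + [:0, 1:] * (Polynomial.smult a f1 \<circ>\<^sub>p ?s) =
        Polynomial.smult a (f0 \<circ>\<^sub>p ?s + [:0, 1:] * (f1 \<circ>\<^sub>p ?s))"
      by (simp only: pcompose_smult mult_smult_right smult_add_right)
    show "enc (Polynomial.smult a f0) (Polynomial.smult a f1) = scale a (enc f0 f1)"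
      unfolding enc_def eq by (rule ev_smult)
  next
    fix f0 f1
    show "enc f0 f1 = 0 \<longleftrightarrow> r dvd f0 \<and> r dvd f1"
      unfolding enc_def ann by (rule even_odd_pcompose_dvd) (simp_all add: r)
  next
    fix f0 f1
    have sq: "[:0, 1:] * [:0, 1:] = ?s + Polynomial.smult (l - m) [:0, 1:]" by simp
    have "v (enc f0 f1) = ev ([:0, 1:] * (f0 \<circ>\<^sub>p ?s + [:0, 1:] * (f1 \<circ>\<^sub>p ?s))) x"
      unfolding enc_def by (simp only: ev_mult ev_X)
    also have "[:0, 1:] * (f0 \<circ>\<^sub>p ?s + [:0, 1:] * (f1 \<circ>\<^sub>p ?s)) =
        [:0, 1:] * (f0 \<circ>\<^sub>p ?s) + ([:0, 1:] * [:0, 1:]) * (f1 \<circ>\<^sub>p ?s)"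
      by (simp only: ring_distribs mult.assoc)
    also have "\<dots> = ([:0, 1:] * f1) \<circ>\<^sub>p ?s + [:0, 1:] * ((f0 + Polynomial.smult (l - m) f1) \<circ>\<^sub>p ?s)"
    proof -
      have "([:0, 1:] * f1) \<circ>\<^sub>p ?s = ?s * (f1 \<circ>\<^sub>p ?s)"
        by (simp add: pcompose_pCons)
      then show ?thesis
        unfolding sq pcompose_add pcompose_smult
        by (simp only: ring_distribs mult_smult_left mult_smult_right ac_simps)
    qed
    finally show "v (enc f0 f1) = enc ([:0, 1:] * f1) (f0 + Polynomial.smult (l - m) f1)"
      by (simp only: enc_def)
  qed
  also have "{enc f0 f1 |f0 f1. True} = range (\<lambda>f. ev f x)"
  proof
    show "{enc f0 f1 |f0 f1. True} \<subseteq> range (\<lambda>f. ev f x)" by (auto simp: enc_def)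
    show "range (\<lambda>f. ev f x) \<subseteq> {enc f0 f1 |f0 f1. True}"
    proof
      fix y assume "y \<in> range (\<lambda>f. ev f x)"
      then obtain f where y: "y = ev f x" by blast
      obtain f0 f1 where "f = f0 \<circ>\<^sub>p ?s + [:0, 1:] * (f1 \<circ>\<^sub>p ?s)"
        using even_odd_pcompose_exists[of f "l - m"] by blast
      then have "y = enc f0 f1" by (simp only: y enc_def)
      then show "y \<in> {enc f0 f1 |f0 f1. True}" by blast
    qed
  qed
  finally show ?thesis .
qed

end

section \<open>Decomposition into cyclic summands\<close>

lemma irreducible_bezout:
  fixes \<pi> f :: "'a::field poly"
  assumes irr: "Factorial_Ring.irreducible \<pi>" and ndvd: "\<not> \<pi> dvd f"
  shows "\<exists>g h. g * f + h * \<pi> = 1"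
proof -
  define I where "I = {g * f + h * \<pi> |g h. True}"
  have "\<pi> \<in> I" unfolding I_def by (rule CollectI, rule exI[of _ 0], rule exI[of _ 1]) simp
  moreover have "\<pi> \<noteq> 0" using irr by auto
  ultimately have "\<exists>d. d \<in> I \<and> d \<noteq> 0" by blast
  \<comment> \<open>By division with remainder, a nonzero element of least degree divides the whole
    ideal.\<close>
  then obtain d where d: "d \<in> I" "d \<noteq> 0"
    and dmin: "\<And>e. e \<in> I \<Longrightarrow> e \<noteq> 0 \<Longrightarrow> Polynomial.degree d \<le> Polynomial.degree e"
    using ex_has_least_nat[of "\<lambda>d. d \<in> I \<and> d \<noteq> 0" _ Polynomial.degree] by blast
  from d obtain g h where gh: "d = g * f + h * \<pi>" by (auto simp: I_def)
  have dvd: "d dvd e" if "e \<in> I" for e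
  proof (rule ccontr)
    assume "\<not> d dvd e"
    then have ne: "e mod d \<noteq> 0" by (simp add: mod_eq_0_iff_dvd)
    from that obtain g' h' where e: "e = g' * f + h' * \<pi>" by (auto simp: I_def)
    have "e mod d = e - e div d * d" by (simp add: minus_div_mult_eq_mod)
    also have "\<dots> = (g' - e div d * g) * f + (h' - e div d * h) * \<pi>"
      by (subst gh, subst e) (simp add: algebra_simps)
    finally have "e mod d \<in> I" unfolding I_def by blast
    from dmin[OF this ne] degree_mod_less'[OF d(2) ne] show False by simp
  qed
  have "f \<in> I" unfolding I_def by (rule CollectI, rule exI[of _ 1], rule exI[of _ 0]) simp
  with dvd have df: "d dvd f" by blast
  from dvd[OF \<open>\<pi> \<in> I\<close>] obtain e where e: "\<pi> = d * e" by (rule dvdE)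
  from irr e have "d dvd 1 \<or> e dvd 1" by (rule irreducibleD)
  then have "d dvd 1"
  proof
    assume "e dvd 1"
    then have "\<pi> dvd d" by (simp add: e mult_unit_dvd_iff)
    with df ndvd show ?thesis by (blast intro: dvd_trans)
  qed
  then obtain c where "1 = d * c" by (rule dvdE)
  then have "(c * g) * f + (c * h) * \<pi> = 1" by (simp add: gh algebra_simps)
  then show ?thesis by blast
qed

text \<open>An inverse of \<open>f\<close> modulo \<open>\<pi>\<close> lifts to every power: the
  induction step inserts the identity for \<open>\<pi>\<close> into the error term
  \<open>h * \<pi> ^ n\<close>.\<close>

lemma irreducible_power_bezout:
  fixes \<pi> f :: "'a::field poly"
  assumes "Factorial_Ring.irreducible \<pi>" and "\<not> \<pi> dvd f"
  shows "\<exists>g h. g * f + h * \<pi> ^ n = 1"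
proof (induction n)
  case 0
  show ?case by (rule exI[of _ 0], rule exI[of _ 1]) simp
next
  case (Suc n)
  then obtain g h where gh: "g * f + h * \<pi> ^ n = 1" by blast
  obtain g' h' where gh': "g' * f + h' * \<pi> = 1" using irreducible_bezout[OF assms] by blast
  have "(g + h * \<pi> ^ n * g') * f + (h * h') * \<pi> ^ Suc n =
      g * f + h * \<pi> ^ n * (g' * f + h' * \<pi>)"
    by (simp add: algebra_simps)
  also have "\<dots> = 1" by (simp only: gh gh' mult_1_right)
  finally show ?case by blast
qed

lemma poly_power_decomp:
  fixes \<pi> f :: "'a::field poly"
  assumes "0 < Polynomial.degree \<pi>" and "f \<noteq> 0"
  shows "\<exists>i g. f = \<pi> ^ i * g \<and> \<not> \<pi> dvd g"
  using assms(2)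
proof (induction "Polynomial.degree f" arbitrary: f rule: less_induct)
  case less
  show ?case
  proof (cases "\<pi> dvd f")
    case False
    then show ?thesis by (intro exI[of _ 0] exI[of _ f]) simp
  next
    case True
    then obtain h where h: "f = \<pi> * h" by (rule dvdE)
    with less.prems have "h \<noteq> 0" "\<pi> \<noteq> 0" by auto
    with h assms(1) have "Polynomial.degree h < Polynomial.degree f"
      by (simp add: Polynomial.degree_mult_eq)
    from less.hyps[OF this \<open>h \<noteq> 0\<close>] obtain i g where "h = \<pi> ^ i * g" "\<not> \<pi> dvd g" by blast
    then show ?thesis by (intro exI[of _ "Suc i"] exI[of _ g]) (simp add: h mult.assoc)
  qed
qed

text \<open>Modulo \<open>\<pi> ^ Suc j\<close> every nonzero ideal contains the class of
  \<open>\<pi> ^ j\<close>: in \<open>f = \<pi> ^ i * f'\<close> the exponent is at most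
  \<open>j\<close> and the cofactor is invertible.\<close>

lemma irreducible_power_combination:
  fixes \<pi> f :: "'a::field poly"
  assumes irr: "Factorial_Ring.irreducible \<pi>" and deg: "0 < Polynomial.degree \<pi>"
    and ndvd: "\<not> \<pi> ^ Suc j dvd f"
  shows "\<exists>g h. g * f + h * \<pi> ^ Suc j = \<pi> ^ j"
proof -
  have "f \<noteq> 0" using ndvd by auto
  then obtain i f' where f: "f = \<pi> ^ i * f'" "\<not> \<pi> dvd f'"
    using poly_power_decomp[OF deg] by blast
  have "\<not> Suc j \<le> i" using ndvd f(1) by (metis dvd_mult2 le_imp_power_dvd)
  then have j: "\<pi> ^ j = \<pi> ^ (j - i) * \<pi> ^ i" by (simp flip: power_add)
  obtain g h where gh: "g * f' + h * \<pi> ^ Suc j = 1"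
    using irreducible_power_bezout[OF irr f(2)] by blast
  have "(g * \<pi> ^ (j - i)) * f + (h * \<pi> ^ j) * \<pi> ^ Suc j =
      g * f' * (\<pi> ^ (j - i) * \<pi> ^ i) + h * \<pi> ^ Suc j * \<pi> ^ j"
    by (simp add: f(1) algebra_simps)
  also have "\<dots> = (g * f' + h * \<pi> ^ Suc j) * \<pi> ^ j"
    by (simp only: j ring_distribs)
  also have "\<dots> = \<pi> ^ j" by (simp only: gh mult_1_left)
  finally show ?thesis by blast
qed

lemma pcompose_power: "(f ^ n) \<circ>\<^sub>p g = (f \<circ>\<^sub>p g) ^ n" for f g :: "'a::field poly"
  by (induction n) (simp_all add: pcompose_1 pcompose_mult)

lemma vector_space_mult: "vector_space ((*) :: 'a::field \<Rightarrow> 'a \<Rightarrow> 'a)"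
  by unfold_locales (simp_all add: algebra_simps)

lemma (in vector_space) linear_functional_exists:
  assumes "w \<noteq> 0"
  shows "\<exists>\<phi>. Vector_Spaces.linear scale (*) \<phi> \<and> \<phi> w = 1"
proof -
  interpret F: vector_space "(*) :: 'a \<Rightarrow> 'a \<Rightarrow> 'a" by (rule vector_space_mult)
  interpret vector_space_pair scale "(*) :: 'a \<Rightarrow> 'a \<Rightarrow> 'a" by unfold_locales
  have "independent {w}" using assms by simp
  from linear_independent_extend[OF this, of "\<lambda>_. 1"] show ?thesis by auto
qed

section \<open>Splitting off cyclic submodules\<close>

locale fin_dim_endo = vector_space_endo scale v + finite_dimensional_vector_space scale Basis
  for scale :: "'a::field \<Rightarrow> 'v::ab_group_add \<Rightarrow> 'v" and v Basis
begin

lemma ev_mem: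
  assumes "subspace S" and "\<And>y. y \<in> S \<Longrightarrow> v y \<in> S" and "y \<in> S"
  shows "ev f y \<in> S"
  by (induction f) (simp_all add: assms ev_pCons subspace_0 subspace_add subspace_scale)

text \<open>
  The complement is the orthogonal of the \<open>v\<close>-submodule of the dual generated by a functional that
  does not vanish at \<open>\<pi>(v)\<^sup>j x\<close>.
\<close>

lemma cyclic_complement:
  assumes irr: "Factorial_Ring.irreducible \<pi>" and deg: "0 < Polynomial.degree \<pi>"
    and S: "subspace S" "\<And>y. y \<in> S \<Longrightarrow> v y \<in> S"
    and kill: "\<And>y. y \<in> S \<Longrightarrow> ev (\<pi> ^ Suc j) y = 0"
    and x: "x \<in> S" "ev (\<pi> ^ j) x \<noteq> 0"
  shows "\<And>f. ev f x = 0 \<longleftrightarrow> \<pi> ^ Suc j dvd f"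
    and "\<exists>T. subspace T \<and> (\<forall>y\<in>T. v y \<in> T) \<and> range (\<lambda>f. ev f x) \<inter> T = {0} \<and> T \<subset> S \<and>
      S = {y + z |y z. y \<in> range (\<lambda>f. ev f x) \<and> z \<in> T}"
proof -
  define w where "w = ev (\<pi> ^ j) x"
  \<comment> \<open>Every nonzero element of the cyclic submodule has \<open>w\<close> among its
    multiples, so a submodule that meets it nontrivially contains \<open>w\<close>.\<close>
  have comb: "\<exists>g. ev g (ev f x) = w" if ndvd: "\<not> \<pi> ^ Suc j dvd f" for f
  proof -
    obtain g h where "g * f + h * \<pi> ^ Suc j = \<pi> ^ j"
      using irreducible_power_combination[OF irr deg ndvd] by blast
    then have "w = ev (g * f) x + ev (h * \<pi> ^ Suc j) x" by (metis ev_add w_def)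
    also have "ev (h * \<pi> ^ Suc j) x = 0" using kill[OF x(1)] by (simp only: ev_mult ev_arg_0)
    finally show ?thesis by (auto simp: ev_mult)
  qed
  show ann: "ev f x = 0 \<longleftrightarrow> \<pi> ^ Suc j dvd f" for f
  proof
    assume "ev f x = 0"
    show "\<pi> ^ Suc j dvd f"
    proof (rule ccontr)
      assume "\<not> \<pi> ^ Suc j dvd f"
      from comb[OF this] \<open>ev f x = 0\<close> have "w = 0" by simp
      with x(2) show False by (simp add: w_def)
    qed
  next
    assume "\<pi> ^ Suc j dvd f"
    then show "ev f x = 0" using kill[OF x(1)] by (rule ev_dvd)
  qed
  obtain \<phi> where \<phi>: "Vector_Spaces.linear scale (*) \<phi>" and \<phi>w: "\<phi> w = 1"
    using linear_functional_exists[of w] x(2) unfolding w_def by blast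
  have \<phi>_add: "\<phi> (y + z) = \<phi> y + \<phi> z" and \<phi>_scale: "\<phi> (scale a y) = a * \<phi> y" for y z a
    using \<phi> by (simp_all add: Vector_Spaces.linear_iff)
  have \<phi>_0: "\<phi> 0 = 0" using \<phi>_scale[of 0 0] by simp
  have \<phi>_sum: "\<phi> (sum g A) = (\<Sum>i\<in>A. \<phi> (g i))" for g and A :: "nat set"
    by (induction A rule: infinite_finite_induct) (simp_all add: \<phi>_add \<phi>_0)
  let ?C = "range (\<lambda>f. ev f x)"
  \<comment> \<open>Stable under \<open>v\<close> because \<open>f\<close> ranges over all
    polynomials. It does not contain \<open>w\<close>, hence meets the cyclic submodule only in
    0.\<close>
  define T where "T = {y \<in> S. \<forall>f. \<phi> (ev f y) = 0}"
  have C: "subspace ?C"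
    unfolding subspace_def
  proof (intro conjI ballI allI)
    show "0 \<in> ?C" by (rule image_eqI[of _ _ 0]) simp_all
    show "y + z \<in> ?C" if "y \<in> ?C" "z \<in> ?C" for y z
      using that by (auto simp flip: ev_add)
    show "scale a y \<in> ?C" if "y \<in> ?C" for a y
      using that by (auto simp flip: ev_smult)
  qed
  have CS: "?C \<subseteq> S" using ev_mem[OF S x(1)] by blast
  have T: "subspace T"
    using S(1) by (auto simp: subspace_def T_def ev_arg_add ev_arg_scale \<phi>_add \<phi>_scale \<phi>_0)
  have Tv: "\<forall>y\<in>T. v y \<in> T"
  proof
    fix y assume "y \<in> T"
    then have "\<phi> (ev (f * [:0, 1:]) y) = 0" for f unfolding T_def by blast
    then have "\<phi> (ev f (v y)) = 0" for f unfolding ev_mult ev_X .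
    with \<open>y \<in> T\<close> show "v y \<in> T" by (simp add: T_def S(2))
  qed
  have CT: "?C \<inter> T = {0}"
  proof
    show "{0} \<subseteq> ?C \<inter> T" using C T by (simp add: subspace_0)
    show "?C \<inter> T \<subseteq> {0}"
    proof
      fix y assume y: "y \<in> ?C \<inter> T"
      then obtain f where f: "y = ev f x" by blast
      have "\<pi> ^ Suc j dvd f"
      proof (rule ccontr)
        assume "\<not> \<pi> ^ Suc j dvd f"
        from comb[OF this] obtain g where "ev g y = w" by (auto simp: f)
        moreover have "\<phi> (ev g y) = 0" using y by (simp add: T_def)
        ultimately show False using \<phi>w by simp
      qed
      with ann f show "y \<in> {0}" by simp
    qed
  qed
  have "w \<in> S" unfolding w_def by (rule ev_mem[OF S x(1)])
  moreover have "w \<notin> T" unfolding T_def using \<phi>w by (auto intro!: exI[of _ 1])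
  ultimately have TS: "T \<subset> S" unfolding T_def by blast
  \<comment> \<open>The values of \<open>\<phi>\<close> at the first \<open>n\<close> iterates of
    \<open>y\<close> become the coefficients of a polynomial of degree below \<open>n\<close>, which
    is applied to \<open>x\<close>. The resulting map \<open>L\<close> has values in
    \<open>?C\<close>, and the elements of \<open>S\<close> that it kills lie in
    \<open>T\<close>.\<close>
  define n where "n = Polynomial.degree (\<pi> ^ Suc j)"
  define P where "P y = (\<Sum>i<n. Polynomial.monom (\<phi> ((v ^^ i) y)) i)" for y
  define L where "L y = ev (P y) x" for y
  have coeff_P: "Polynomial.coeff (P y) i = (if i < n then \<phi> ((v ^^ i) y) else 0)" for y i
    by (simp add: P_def Polynomial.coeff_sum if_distrib sum.If_cases cong: if_cong)
  have ev_pow: "(v ^^ i) y = ev (Polynomial.monom 1 i) y" for i y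
    by (simp add: ev_monom)
  have "P (y + z) = P y + P z" for y z
    by (rule poly_eqI) (simp add: coeff_P ev_pow ev_arg_add \<phi>_add)
  moreover have "P (scale a y) = Polynomial.smult a (P y)" for a y
    by (rule poly_eqI) (simp add: coeff_P ev_pow ev_arg_scale \<phi>_scale)
  ultimately have L: "Vector_Spaces.linear scale scale L"
    by (simp add: Vector_Spaces.linear_iff vector_space_axioms L_def ev_add ev_smult)
  have npos: "0 < n" using deg irr unfolding n_def by (subst Polynomial.degree_power_eq) auto
  have L_T: "y \<in> T" if "y \<in> S" "L y = 0" for y
  proof -
    have "\<pi> ^ Suc j dvd P y" using that(2) ann by (simp add: L_def)
    moreover have "Polynomial.degree (P y) < n"
      using npos by (metis Polynomial.degree_0 coeff_P leading_coeff_0_iff)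
    ultimately have "P y = 0" unfolding n_def by (meson dvd_imp_degree_le linorder_not_less)
    then have low: "\<phi> ((v ^^ i) y) = 0" if "i < n" for i
      using coeff_P[of y i] that by simp
    \<comment> \<open>Reduction modulo \<open>\<pi> ^ Suc j\<close> leaves only exponents below
      \<open>n\<close>, so the first \<open>n\<close> values decide all of them.\<close>
    have "\<phi> (ev f y) = 0" for f
    proof -
      define g where "g = f mod \<pi> ^ Suc j"
      have "ev f y = ev (f div \<pi> ^ Suc j) (ev (\<pi> ^ Suc j) y) + ev g y"
        unfolding g_def by (metis div_mult_mod_eq ev_add ev_mult)
      then have fg: "ev f y = ev g y" using kill[OF that(1)] by (simp only: ev_arg_0 add_0)
      have "Polynomial.degree g < n"
      proof -
        have "\<pi> ^ Suc j \<noteq> 0" using npos unfolding n_def by force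
        from degree_mod_less[OF this, of f] npos show ?thesis unfolding n_def g_def by auto
      qed
      then have "\<phi> (ev g y) = 0"
        unfolding poly_endo_def \<phi>_sum by (intro sum.neutral) (simp add: \<phi>_scale low)
      then show ?thesis by (simp add: fg)
    qed
    with that(1) show ?thesis by (simp add: T_def)
  qed
  have LC: "L y \<in> ?C" for y by (simp add: L_def)
  interpret L: Vector_Spaces.linear scale scale L by (rule L)
  interpret VV: finite_dimensional_vector_space_pair_1 scale Basis scale by unfold_locales
  have inj: "inj_on L ?C"
  proof (rule inj_onI)
    fix y z assume "y \<in> ?C" "z \<in> ?C" "L y = L z"
    then have "y - z \<in> ?C" "L (y - z) = 0" using C by (auto simp: subspace_diff L.diff)
    then have "y - z \<in> ?C \<inter> T" using L_T CS by blast
    then show "y = z" using CT by simp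
  qed
  \<comment> \<open>Injectivity and equal dimensions. Each \<open>L y\<close> is then some
    \<open>L c\<close> with \<open>c\<close> in \<open>?C\<close>, and \<open>y - c\<close> falls
    into \<open>T\<close>.\<close>
  have img: "L ` ?C = ?C"
  proof (rule subspace_dim_equal)
    show "subspace (L ` ?C)" by (rule L.subspace_image[OF C])
    show "subspace ?C" by (rule C)
    show "L ` ?C \<subseteq> ?C" using LC by blast
    have "dim (L ` ?C) = dim ?C"
      using VV.dim_image_eq[OF L] inj C by (metis span_eq_iff)
    then show "dim ?C \<le> dim (L ` ?C)" by simp
  qed
  have "S \<subseteq> {y + z |y z. y \<in> ?C \<and> z \<in> T}"
  proof
    fix y assume y: "y \<in> S"
    have "L y \<in> L ` ?C" using LC img by simp
    then obtain c where c: "c \<in> ?C" "L y = L c" by blast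
    have "y - c \<in> S" using y c CS S(1) by (auto intro: subspace_diff)
    moreover have "L (y - c) = 0" using c(2) by (simp add: L.diff)
    ultimately have "y - c \<in> T" by (rule L_T)
    moreover have "y = c + (y - c)" by simp
    ultimately show "y \<in> {y + z |y z. y \<in> ?C \<and> z \<in> T}" using c(1) by blast
  qed
  moreover have "{y + z |y z. y \<in> ?C \<and> z \<in> T} \<subseteq> S"
    using CS TS S(1) by (auto intro!: subspace_add)
  ultimately show "\<exists>T. subspace T \<and> (\<forall>y\<in>T. v y \<in> T) \<and> ?C \<inter> T = {0} \<and> T \<subset> S \<and>
      S = {y + z |y z. y \<in> ?C \<and> z \<in> T}"
    using T Tv CT TS by blast
qed

text \<open>Induction on the dimension. A vector of maximal order generates a cyclic summand, which
  is of the required kind because a power of \<open>\<rho>(s)\<close> is again a polynomial in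
  \<open>s\<close>; the complement is smaller.\<close>

lemma splits_primary:
  assumes irr: "Factorial_Ring.irreducible (\<rho> \<circ>\<^sub>p [:0, - (l - m), 1:])"
    and deg: "0 < Polynomial.degree \<rho>"
    and kill: "\<And>y. ev ((\<rho> \<circ>\<^sub>p [:0, - (l - m), 1:]) ^ K) y = 0"
    and "subspace S" and "\<And>y. y \<in> S \<Longrightarrow> v y \<in> S"
  shows "splits scale l m k v S"
  using assms(4-5)
proof (induction "dim S" arbitrary: S rule: less_induct)
  case less
  let ?\<pi> = "\<rho> \<circ>\<^sub>p [:0, - (l - m), 1:]"
  show ?case
  proof (cases "S = {0}")
    case True
    then show ?thesis by (simp add: splits_zero)
  next
    case False
    have \<pi>: "0 < Polynomial.degree ?\<pi>" using deg by (simp add: Polynomial.degree_pcompose)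
    define n where "n = (LEAST n. \<forall>y\<in>S. ev (?\<pi> ^ n) y = 0)"
    have "\<forall>y\<in>S. ev (?\<pi> ^ K) y = 0" using kill by blast
    then have n: "\<forall>y\<in>S. ev (?\<pi> ^ n) y = 0" unfolding n_def by (rule LeastI)
    have "n \<noteq> 0"
    proof
      assume "n = 0"
      with n have "\<forall>y\<in>S. y = 0" by simp
      with False less.prems(1) show False by (auto dest: subspace_0)
    qed
    then obtain j where j: "n = Suc j" by (cases n) auto
    have "\<not> (\<forall>y\<in>S. ev (?\<pi> ^ j) y = 0)" 
      using not_less_Least[of j "\<lambda>n. \<forall>y\<in>S. ev (?\<pi> ^ n) y = 0"] j unfolding n_def by simp
    then obtain x where x: "x \<in> S" "ev (?\<pi> ^ j) x \<noteq> 0" by blast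
    have kill': "ev (?\<pi> ^ Suc j) y = 0" if "y \<in> S" for y
      using n that unfolding j by blast
    note cc = cyclic_complement[OF irr \<pi> less.prems kill' x]
    obtain T where T: "subspace T" "\<forall>y\<in>T. v y \<in> T" "range (\<lambda>f. ev f x) \<inter> T = {0}" "T \<subset> S"
      "S = {y + z |y z. y \<in> range (\<lambda>f. ev f x) \<and> z \<in> T}"
      using cc(2) by blast
    have "dim T < dim S"
      using T(1,4) less.prems(1) by (intro dim_psubset) (metis span_eq_iff)
    then have "splits scale l m k v T" using T(1,2) by (intro less.hyps) auto
    moreover have "splits scale l m k v (range (\<lambda>f. ev f x))"
    proof (rule splits_cyclic)
      show "0 < Polynomial.degree (\<rho> ^ Suc j)"
        using deg by (subst Polynomial.degree_power_eq) auto
      show "ev f x = 0 \<longleftrightarrow> \<rho> ^ Suc j \<circ>\<^sub>p [:0, - (l - m), 1:] dvd f" for f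
        unfolding pcompose_power by (rule cc(1))
    qed
    moreover have "subspace (range (\<lambda>f. ev f x))"
      unfolding subspace_def
      by (auto simp flip: ev_add ev_smult intro: image_eqI[of _ _ 0])
    ultimately show ?thesis
      by (subst T(5)) (intro splits_sum T linear_v)
  qed
qed

end

section \<open>The symplectic extension\<close>

context fin_dim_endo
begin

text \<open>Nondegeneracy embeds \<open>V\<close> in its dual, and equal dimensions make the
  embedding onto.\<close>

lemma symplectic_form_surjective:
  assumes N: "symplectic_form scale UNIV N" and \<phi>: "\<phi> \<in> dual scale"
  shows "\<exists>x. N x = \<phi>"
proof -
  have N_add: "N (x + y) z = N x z + N y z" "N z (x + y) = N z x + N z y"
    and N_scale: "N (scale c x) z = c * N x z" "N z (scale c x) = c * N z x" for x y z c
    using N by (simp_all add: symplectic_form_def bilinear_on_def)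
  have \<phi>_add: "\<phi> (x + y) = \<phi> x + \<phi> y" and \<phi>_scale: "\<phi> (scale c x) = c * \<phi> x" for x y c
    using \<phi> by (simp_all add: dual_def Vector_Spaces.linear_iff)
  have ext: "f = g" if "\<And>x y. f (x + y) = f x + f y" "\<And>c x. f (scale c x) = c * f x"
    "\<And>x y. g (x + y) = g x + g y" "\<And>c x. g (scale c x) = c * g x"
    "\<And>b. b \<in> Basis \<Longrightarrow> f b = g b" for f g :: "'v \<Rightarrow> 'a"
  proof
    fix x
    have "x \<in> span Basis" by (simp add: span_Basis)
    then show "f x = g x"
    proof (induction rule: span_induct_alt)
      case base
      show ?case using that(2)[of 0 0] that(4)[of 0 0] by simp
    next
      case (step c x y)
      then show ?case by (simp add: that)
    qed
  qed
  \<comment> \<open>The functional \<open>N x\<close> is stored as the vector with coordinates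
    \<open>N x b\<close>. So the dimension count becomes: an injective endomorphism of
    \<open>V\<close> is surjective.\<close>
  define L where "L x = (\<Sum>b\<in>Basis. scale (N x b) b)" for x
  have L: "Vector_Spaces.linear scale scale L"
    by (simp add: Vector_Spaces.linear_iff vector_space_axioms L_def N_add N_scale
        scale_left_distrib sum.distrib scale_sum_right)
  interpret L: Vector_Spaces.linear scale scale L by (rule L)
  interpret VV: finite_dimensional_vector_space_pair scale Basis scale Basis by unfold_locales
  have coord: "f b = g b"
    if "(\<Sum>b\<in>Basis. scale (f b) b) = (\<Sum>b\<in>Basis. scale (g b) b)" "b \<in> Basis" for f g :: "'v \<Rightarrow> 'a" and b
  proof -
    have "(\<Sum>b\<in>Basis. scale (f b - g b) b) = 0"
      using that(1) by (simp add: scale_left_diff_distrib sum_subtractf)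
    then have "f b - g b = 0"
      using independentD[OF independent_Basis finite_Basis subset_refl _ that(2), of "\<lambda>b. f b - g b"]
      by simp
    then show ?thesis by simp
  qed
  have "inj L"
  proof (rule injI)
    fix y z assume "L y = L z"
    define x where "x = y - z"
    have "L x = 0" using \<open>L y = L z\<close> by (simp add: x_def L.diff)
    then have "N x b = 0" if "b \<in> Basis" for b
      using coord[of "N x" "\<lambda>_. 0", OF _ that] by (simp add: L_def)
    then have "N x = (\<lambda>_. 0)" by (intro ext) (simp_all add: N_add N_scale)
    then have "\<forall>y\<in>UNIV. N x y = 0" by simp
    then have "x = 0" using N unfolding symplectic_form_def by blast
    then show "y = z" by (simp add: x_def)
  qed
  then have "surj L" by (rule VV.linear_injective_imp_surjective[OF L]) simp
  then obtain x where "L x = (\<Sum>b\<in>Basis. scale (\<phi> b) b)" by (metis surjD)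
  then have "N x = \<phi>" unfolding L_def
    by (intro ext) (auto simp: N_add N_scale \<phi>_add \<phi>_scale dest: coord)
  then show ?thesis by blast
qed

section \<open>The symplectic pair on the double space\<close>

lemma double_scale_simps: "double_scale scale c (x, \<phi>) = (scale c x, \<lambda>y. c * \<phi> y)"
  by (simp add: double_scale_def)

lemma double_form_simps: "double_form (x, \<phi>) (y, \<psi>) = \<phi> y - \<psi> x"
  by (simp add: double_form_def)

lemma symplectic_pair_double:
  "symplectic_pair (double_scale scale) (double_space scale) (symplectic_extension v)"
proof -
  have dualD: "\<phi> (x + y) = \<phi> x + \<phi> y" "\<phi> (scale c x) = c * \<phi> x" if "\<phi> \<in> dual scale" for \<phi> x y c
    using that by (simp_all add: dual_def Vector_Spaces.linear_iff)
  have dualI: "\<phi> \<in> dual scale" if "\<And>x y. \<phi> (x + y) = \<phi> x + \<phi> y" "\<And>c x. \<phi> (scale c x) = c * \<phi> x" for \<phi>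
    using that by (simp add: dual_def Vector_Spaces.linear_iff vector_space_axioms vector_space_mult)
  interpret D: vector_space "double_scale scale"
    by unfold_locales
      (auto simp: double_scale_simps scale_right_distrib scale_left_distrib algebra_simps plus_fun_def)
  have sub: "D.subspace (double_space scale)"
    unfolding D.subspace_def double_space_def
    by (auto simp: zero_prod_def double_scale_simps dualD algebra_simps intro!: dualI)
  \<comment> \<open>Coordinate functionals: \<open>B\<close> below is the basis of \<open>V\<close>
    joined with its dual basis.\<close>
  define crd where "crd b x = representation Basis x b" for b x
  have crd: "crd b \<in> dual scale" for b
    by (rule dualI)
      (simp_all add: crd_def representation_add representation_scale independent_Basis span_Basis)
  define B where "B = (\<lambda>b. (b, \<lambda>_. 0)) ` Basis \<union> (\<lambda>b. (0, crd b)) ` Basis"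
  have "D.span B = double_space scale"
  proof
    have "B \<subseteq> double_space scale"
      using crd by (auto simp: B_def double_space_def intro: dualI)
    then show "D.span B \<subseteq> double_space scale" using sub by (rule D.span_minimal)
    show "double_space scale \<subseteq> D.span B"
    proof
      fix z assume "z \<in> double_space scale"
      then obtain x \<phi> where z: "z = (x, \<phi>)" and \<phi>: "\<phi> \<in> dual scale"
        by (auto simp: double_space_def)
      have sum_rep: "(\<Sum>b\<in>Basis. scale (crd b y) b) = y" for y
        unfolding crd_def
        by (rule sum_representation_eq) (simp_all add: independent_Basis span_Basis finite_Basis)
      have \<phi>_sum: "\<phi> (\<Sum>b\<in>A. scale (g b) b) = (\<Sum>b\<in>A. g b * \<phi> b)" for A g
        using dualD(2)[OF \<phi>, of 0 0]
        by (induction A rule: infinite_finite_induct) (simp_all add: dualD[OF \<phi>])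
      have \<phi>_eq: "(\<Sum>b\<in>Basis. \<phi> b * crd b y) = \<phi> y" for y
        using \<phi>_sum[of "\<lambda>b. crd b y" Basis] by (simp add: sum_rep mult.commute)
      have fst_sum: "(\<Sum>b\<in>A. double_scale scale (g b) (b, \<lambda>_. 0)) = (\<Sum>b\<in>A. scale (g b) b, \<lambda>_. 0)"
        for A g
        by (induction A rule: infinite_finite_induct)
          (simp_all add: double_scale_simps zero_prod_def zero_fun_def plus_fun_def)
      have snd_sum: "(\<Sum>b\<in>A. double_scale scale (g b) (0, crd b)) = (0, \<lambda>y. \<Sum>b\<in>A. g b * crd b y)"
        for A g
        by (induction A rule: infinite_finite_induct)
          (simp_all add: double_scale_simps zero_prod_def zero_fun_def plus_fun_def)
      have "z = (\<Sum>b\<in>Basis. double_scale scale (crd b x) (b, \<lambda>_. 0)) +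
          (\<Sum>b\<in>Basis. double_scale scale (\<phi> b) (0, crd b))"
        unfolding fst_sum snd_sum z sum_rep by (simp add: \<phi>_eq plus_fun_def)
      also have "\<dots> \<in> D.span B"
        by (intro D.span_add D.span_sum D.span_scale D.span_base) (auto simp: B_def)
      finally show "z \<in> D.span B" .
    qed
  qed
  moreover have "finite B" by (simp add: B_def finite_Basis)
  ultimately have "fin_dim_space (double_scale scale) (double_space scale)"
    unfolding fin_dim_space_def using sub D.vector_space_axioms by blast
  moreover have "symplectic_form (double_scale scale) (double_space scale) double_form"
    unfolding symplectic_form_def bilinear_on_def
  proof (intro conjI ballI impI allI)
    fix z assume "z \<in> double_space scale" and *: "\<forall>w\<in>double_space scale. double_form z w = 0"
    then obtain x \<phi> where z: "z = (x, \<phi>)" "\<phi> \<in> dual scale" by (auto simp: double_space_def)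
    have "\<phi> y = 0" for y
    proof -
      have "(y, \<lambda>_. 0) \<in> double_space scale" by (auto simp: double_space_def intro: dualI)
      from *[rule_format, OF this] show ?thesis by (simp add: z double_form_simps)
    qed
    moreover have "x = 0"
    proof (rule ccontr)
      assume "x \<noteq> 0"
      from linear_functional_exists[OF this] obtain \<psi> where \<psi>: "\<psi> \<in> dual scale" "\<psi> x = 1"
        by (auto simp: dual_def)
      then have "(0, \<psi>) \<in> double_space scale" by (simp add: double_space_def)
      from *[rule_format, OF this] show False
        using \<psi> dualD(2)[OF z(2), of 0 0] by (simp add: z double_form_simps)
    qed
    ultimately show "z = 0" by (simp add: z zero_prod_def zero_fun_def fun_eq_iff)
  qed (auto simp: double_space_def double_form_simps double_scale_simps dualD algebra_simps)
  moreover have "alternating_endomorphism (double_scale scale) (double_space scale) double_form (double_endo v)"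
    unfolding alternating_endomorphism_def endomorphism_on_def double_space_def double_endo_def
    by (auto simp: double_form_simps double_scale_simps v_add v_scale dualD fun_eq_iff intro: dualI)
  ultimately show ?thesis
    by (simp add: symplectic_pair_def symplectic_extension_def)
qed

section \<open>Block endomorphisms annihilated by a quadratic polynomial\<close>

lemma poly_endo_quadratic:
  assumes "Polynomial.degree r = 2" "monic r"
  shows "poly_endo sc r u x = sc (Polynomial.coeff r 0) x + sc (- tr r) (u x) + sc 1 (u (u x))"
  using assms by (simp add: poly_endo_def tr_def numeral_2_eq_2)

text \<open>The block matrix \<open>(D, -a N\<inverse>; N, D\<^sup>t)\<close>, where \<open>M\<close> stands for \<open>N\<inverse>\<close>.\<close>

definition block_endo ::
    "('v \<Rightarrow> 'v \<Rightarrow> 'a) \<Rightarrow> (('v \<Rightarrow> 'a) \<Rightarrow> 'v) \<Rightarrow> 'a \<Rightarrow> ('v \<Rightarrow> 'v) \<Rightarrow> 'v \<times> ('v \<Rightarrow> 'a) \<Rightarrow> 'v \<times> ('v \<Rightarrow> 'a)" where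
  "block_endo N M a D = (\<lambda>(x, \<phi>). (D x - scale a (M \<phi>), \<lambda>y. N x y + \<phi> (D y)))"

text \<open>Let \<open>c\<close> be the constant term of \<open>r\<close>. The diagonal blocks of
  the square are \<open>D^2 - a = tr r D - c\<close> and its transpose; the off-diagonal blocks are
  \<open>tr r\<close> times those of the matrix, because the adjoint of \<open>D\<close> is
  \<open>tr r - D\<close>. So the square is \<open>tr r\<close> times the matrix, minus
  \<open>c\<close>. Alternation reduces to that of \<open>N\<close>.\<close>

lemma block_endo:
  assumes N: "symplectic_form scale UNIV N"
    and M: "\<And>\<phi>. \<phi> \<in> dual scale \<Longrightarrow> N (M \<phi>) = \<phi>"
    and r: "Polynomial.degree r = 2" "monic r"
    and D: "quadratic_adjoint scale UNIV N (tr r) (Polynomial.coeff r 0 - a) D"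
  shows "alternating_endomorphism (double_scale scale) (double_space scale) double_form (block_endo N M a D)"
    and "\<forall>z\<in>double_space scale. poly_endo (double_scale scale) r (block_endo N M a D) z = 0"
proof -
  have N_add: "N (x + y) z = N x z + N y z" "N z (x + y) = N z x + N z y"
    and N_scale: "N (scale c x) z = c * N x z" "N z (scale c x) = c * N z x"
    and N_self: "N x x = 0" for x y z c
    using N by (simp_all add: symplectic_form_def bilinear_on_def)
  have N_diff: "N (x - y) z = N x z - N y z" for x y z
    using N_add(1)[of "x - y" y z] by simp
  have N_inj: "x = y" if "N x = N y" for x y
  proof -
    have "\<forall>z\<in>UNIV. N (x - y) z = 0" by (simp add: N_diff that)
    then have "x - y = 0" using N unfolding symplectic_form_def by blast
    then show ?thesis by simp
  qed
  have D_add: "D (x + y) = D x + D y" and D_scale: "D (scale c x) = scale c (D x)" for x y c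
    using D by (simp_all add: quadratic_adjoint_def endomorphism_on_def)
  have D_diff: "D (x - y) = D x - D y" for x y
    using D_add[of "x - y" y] by simp
  have D_adj: "N (D x) y + N x (D y) = tr r * N x y"
    and D_sq: "D (D x) = scale (tr r) (D x) - scale (Polynomial.coeff r 0 - a) x" for x y
    using D by (simp_all add: quadratic_adjoint_def)
  have dualD: "\<phi> (x + y) = \<phi> x + \<phi> y" "\<phi> (scale c x) = c * \<phi> x" if "\<phi> \<in> dual scale" for \<phi> x y c
    using that by (simp_all add: dual_def Vector_Spaces.linear_iff)
  have dualI: "\<phi> \<in> dual scale" if "\<And>x y. \<phi> (x + y) = \<phi> x + \<phi> y" "\<And>c x. \<phi> (scale c x) = c * \<phi> x" for \<phi>
    using that by (simp add: dual_def Vector_Spaces.linear_iff vector_space_axioms vector_space_mult)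
  have dual_diff: "\<phi> (x - y) = \<phi> x - \<phi> y" if "\<phi> \<in> dual scale" for \<phi> x y
    using dualD(1)[OF that, of "x - y" y] by simp
  have N_dual: "N x \<in> dual scale" for x
    by (rule dualI) (simp_all add: N_add N_scale)
  have dual_add: "(\<lambda>y. \<phi> y + \<psi> y) \<in> dual scale" if "\<phi> \<in> dual scale" "\<psi> \<in> dual scale" for \<phi> \<psi>
    by (rule dualI) (simp_all add: dualD that algebra_simps)
  have dual_D: "(\<lambda>y. \<phi> (D y)) \<in> dual scale" if "\<phi> \<in> dual scale" for \<phi>
    by (rule dualI) (simp_all add: dualD that D_add D_scale)
  have M_eq: "M \<phi> = x" if "\<phi> = N x" for \<phi> x
    using N_inj M[OF N_dual] that by blast
  have M_app: "N (M \<phi>) y = \<phi> y" if "\<phi> \<in> dual scale" for \<phi> y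
    using M[OF that] by simp
  have M_add: "M (\<lambda>y. \<phi> y + \<psi> y) = M \<phi> + M \<psi>" if "\<phi> \<in> dual scale" "\<psi> \<in> dual scale" for \<phi> \<psi>
    by (rule M_eq) (simp add: fun_eq_iff N_add M_app that)
  have M_scale: "M (\<lambda>y. c * \<phi> y) = scale c (M \<phi>)" if "\<phi> \<in> dual scale" for \<phi> c
    by (rule M_eq) (simp add: fun_eq_iff N_scale M_app that)
  have M_N: "M (N x) = x" for x by (rule M_eq) simp
  \<comment> \<open>The adjoint relation carried over to the dual:
    \<open>M D^t = (tr r - D) M\<close>.\<close>
  have M_D: "M (\<lambda>y. \<phi> (D y)) = scale (tr r) (M \<phi>) - D (M \<phi>)" if "\<phi> \<in> dual scale" for \<phi>
  proof (rule M_eq, rule ext)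
    fix y
    show "\<phi> (D y) = N (scale (tr r) (M \<phi>) - D (M \<phi>)) y"
      using D_adj[of "M \<phi>" y] by (simp add: N_diff N_scale M_app that algebra_simps)
  qed
  let ?u = "block_endo N M a D"
  have u: "?u (x, \<phi>) = (D x - scale a (M \<phi>), \<lambda>y. N x y + \<phi> (D y))" for x \<phi>
    by (simp add: block_endo_def)
  show "alternating_endomorphism (double_scale scale) (double_space scale) double_form ?u"
    unfolding alternating_endomorphism_def endomorphism_on_def
  proof (intro conjI ballI allI)
    fix z assume "z \<in> double_space scale"
    then obtain x \<phi> where z: "z = (x, \<phi>)" and \<phi>: "\<phi> \<in> dual scale" by (auto simp: double_space_def)
    show "?u z \<in> double_space scale"
      by (simp add: z u double_space_def dual_add N_dual dual_D \<phi>)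
    show "?u (double_scale scale c z) = double_scale scale c (?u z)" for c
      by (simp add: z u double_scale_simps D_scale N_scale M_scale \<phi> scale_right_diff_distrib
          fun_eq_iff algebra_simps)
    have "\<phi> (M \<phi>) = 0" using M_app[OF \<phi>, of "M \<phi>"] N_self by metis
    then show "double_form z (?u z) = 0"
      by (simp add: z u double_form_simps dual_diff dualD \<phi> N_self)
    fix w assume "w \<in> double_space scale"
    then obtain y \<psi> where w: "w = (y, \<psi>)" and \<psi>: "\<psi> \<in> dual scale" by (auto simp: double_space_def)
    show "?u (z + w) = ?u z + ?u w"
      by (simp add: z w u plus_fun_def D_add N_add M_add \<phi> \<psi> scale_right_distrib fun_eq_iff)
  qed
  show "\<forall>z\<in>double_space scale. poly_endo (double_scale scale) r ?u z = 0"
  proof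
    fix z assume "z \<in> double_space scale"
    then obtain x \<phi> where z: "z = (x, \<phi>)" and \<phi>: "\<phi> \<in> dual scale" by (auto simp: double_space_def)
    have 1: "scale (Polynomial.coeff r 0) x + scale (- tr r) (D x - scale a (M \<phi>)) +
        (D (D x - scale a (M \<phi>)) - scale a (M (\<lambda>y. N x y + \<phi> (D y)))) = 0"
      by (simp add: M_add N_dual dual_D M_N M_D \<phi> D_diff D_scale D_sq algebra_simps
          scale_right_distrib scale_right_diff_distrib scale_left_diff_distrib)
    have 2: "Polynomial.coeff r 0 * \<phi> y + - tr r * (N x y + \<phi> (D y)) +
        (N (D x - scale a (M \<phi>)) y + (N x (D y) + \<phi> (D (D y)))) = 0" for y
      using D_adj[of x y]
      by (simp add: N_diff N_scale M_app \<phi> D_sq dual_diff dualD algebra_simps)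
    show "poly_endo (double_scale scale) r ?u z = 0"
      unfolding poly_endo_quadratic[OF r] z u double_scale_simps
      using 1 2 by (simp add: zero_prod_def zero_fun_def plus_fun_def fun_eq_iff)
  qed
qed

text \<open>Both block matrices use the constant term of \<open>p\<close> as \<open>a\<close>, so
  their off-diagonal blocks cancel in the difference, which leaves \<open>D - E = v\<close> and its
  transpose.\<close>

lemma splits_symplectic_difference:
  assumes p: "Polynomial.degree p = 2" "monic p" and q: "Polynomial.degree q = 2" "monic q"
    and "splits scale (tr p) (tr q) (Polynomial.coeff q 0 - Polynomial.coeff p 0) v UNIV"
  shows "symplectic_difference (double_scale scale) (double_space scale) p q (symplectic_extension v)"
proof -
  obtain N D E where N: "symplectic_form scale UNIV N"
    and D: "quadratic_adjoint scale UNIV N (tr p) 0 D"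
    and E: "quadratic_adjoint scale UNIV N (tr q) (Polynomial.coeff q 0 - Polynomial.coeff p 0) E"
    and v: "\<And>x. v x = D x - E x"
    using assms(5) unfolding splits_def by auto
  define M where "M \<phi> = (SOME x. N x = \<phi>)" for \<phi>
  have M: "N (M \<phi>) = \<phi>" if "\<phi> \<in> dual scale" for \<phi>
    unfolding M_def using symplectic_form_surjective[OF N that] by (rule someI_ex)
  let ?a = "Polynomial.coeff p 0"
  have D': "quadratic_adjoint scale UNIV N (tr p) (Polynomial.coeff p 0 - ?a) D" using D by simp
  let ?u1 = "block_endo N M ?a D" and ?u2 = "block_endo N M ?a E"
  have "\<forall>z\<in>double_space scale. double_endo v z = ?u1 z - ?u2 z"
  proof
    fix z assume "z \<in> double_space scale"
    then obtain x \<phi> where z: "z = (x, \<phi>)" and \<phi>: "\<phi> \<in> dual scale" by (auto simp: double_space_def)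
    have "\<phi> (D y) = \<phi> (v y) + \<phi> (E y)" for y
      using \<phi> v[of y] by (metis (mono_tags, lifting) Vector_Spaces.linear_iff diff_add_cancel dual_def mem_Collect_eq)
    then show "double_endo v z = ?u1 z - ?u2 z"
      by (simp add: z double_endo_def block_endo_def v fun_eq_iff)
  qed
  then show ?thesis
    using symplectic_pair_double block_endo[OF N M p D'] block_endo[OF N M q E]
    unfolding symplectic_difference_def symplectic_extension_def by blast
qed

end

section \<open>Exceptional endomorphisms\<close>

context fin_dim_endo
begin

lemma annihilating_poly_exists: "\<exists>f. f \<noteq> 0 \<and> ev f x = 0"
proof (rule ccontr)
  assume "\<not> ?thesis"
  then have no: "f = 0" if "ev f x = 0" for f using that by blast
  define n where "n = card Basis"
  define g where "g i = (v ^^ i) x" for i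
  \<comment> \<open>A repeated iterate would already give an annihilating polynomial. So these are
    \<open>n + 1\<close> distinct vectors, and their linear dependence is a relation indexed by
    exponents.\<close>
  have inj: "inj_on g {..n}"
  proof (rule inj_onI)
    fix i j assume "g i = g j"
    then have "ev (Polynomial.monom 1 i - Polynomial.monom 1 j) x = 0"
      by (simp add: ev_diff ev_monom g_def)
    then have "Polynomial.monom (1::'a) i = Polynomial.monom 1 j" using no by fastforce
    then show "i = j" by (metis Polynomial.degree_monom_eq one_neq_zero)
  qed
  have "dependent (g ` {..n})"
  proof (rule ccontr)
    assume "independent (g ` {..n})"
    from independent_card_le_dim[OF subset_UNIV this] have "card (g ` {..n}) \<le> n"
      by (simp add: n_def)
    then show False by (simp add: card_image[OF inj])
  qed
  then obtain u j where u: "(\<Sum>w\<in>g ` {..n}. scale (u w) w) = 0" and j: "j \<le> n" "u (g j) \<noteq> 0"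
    unfolding dependent_finite[OF finite_imageI[OF finite_atMost]] by auto
  define f where "f = (\<Sum>i\<le>n. Polynomial.monom (u (g i)) i)"
  have coeff_f: "Polynomial.coeff f i = (if i \<le> n then u (g i) else 0)" for i
    by (simp add: f_def Polynomial.coeff_sum)
  have "Polynomial.degree f \<le> n"
    by (rule Polynomial.degree_le) (simp add: coeff_f)
  then have "ev f x = (\<Sum>i\<le>n. scale (u (g i)) (g i))"
    by (simp add: ev_alt coeff_f g_def)
  also have "\<dots> = 0" using u by (simp add: sum.reindex[OF inj])
  finally have "f = 0" by (rule no)
  with coeff_f[of j] j show False by simp
qed

end

text \<open>Linear factors are stripped from \<open>f\<close> one at a time. Once the remaining
  cofactor no longer kills \<open>w\<close>, it sends \<open>w\<close> to an eigenvector for the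
  root stripped last. The hypothesis \<open>root\<close> expresses algebraic closedness.\<close>

lemma (in vector_space_endo) eigenvector_exists:
  assumes root: "\<And>g :: 'a poly. 0 < Polynomial.degree g \<Longrightarrow> \<exists>l. poly g l = 0"
    and "f \<noteq> 0" and "ev f w = 0" and "w \<noteq> 0"
  shows "\<exists>l g. poly f l = 0 \<and> ev g w \<noteq> 0 \<and> v (ev g w) = scale l (ev g w)"
  using assms(2-3)
proof (induction "Polynomial.degree f" arbitrary: f rule: less_induct)
  case less
  have "Polynomial.degree f \<noteq> 0"
  proof
    assume "Polynomial.degree f = 0"
    then obtain c where "f = [:c:]" by (rule degree_eq_zeroE)
    with less.prems assms(4) show False by (simp add: ev_const)
  qed
  then obtain l where l: "poly f l = 0" using root by blast
  then obtain h where h: "f = [:- l, 1:] * h" unfolding poly_eq_0_iff_dvd by (rule dvdE)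
  show ?case
  proof (cases "ev h w = 0")
    case True
    have "h \<noteq> 0" using h less.prems(1) by auto
    then have "Polynomial.degree h < Polynomial.degree f"
      unfolding h by (subst Polynomial.degree_mult_eq) auto
    from less.hyps[OF this \<open>h \<noteq> 0\<close> True] show ?thesis by (auto simp: h)
  next
    case False
    have "ev [:- l, 1:] (ev h w) = 0" using less.prems(2) by (simp only: h ev_mult)
    then have "v (ev h w) = scale l (ev h w)" by (simp add: ev_pCons)
    with l False show ?thesis by blast
  qed
qed

section \<open>Extension of scalars to the algebraic closure\<close>

lemma map_poly_to_ac_pCons: "map_poly to_ac (pCons a f) = pCons (to_ac a) (map_poly to_ac f)"
  by (rule poly_eqI) (simp add: coeff_map_poly coeff_pCons split: nat.split)

lemma map_poly_to_ac_add: "map_poly to_ac (f + g) = map_poly to_ac f + map_poly to_ac g"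
  by (rule poly_eqI) (simp add: coeff_map_poly)

lemma map_poly_to_ac_smult: "map_poly to_ac (Polynomial.smult a f) = Polynomial.smult (to_ac a) (map_poly to_ac f)"
  by (rule poly_eqI) (simp add: coeff_map_poly)

lemma map_poly_to_ac_mult: "map_poly to_ac (f * g) = map_poly to_ac f * map_poly to_ac g"
  by (induction f) (simp_all add: map_poly_to_ac_pCons map_poly_to_ac_add map_poly_to_ac_smult)

context fin_dim_endo
begin

text \<open>
  The scalars are extended by letting the matrix of \<open>v\<close> act on functions from the ground type to the
  algebraic closure; only their values on the basis matter.
\<close>

lemma eigenvalue_annihilator_root:
  assumes "f \<noteq> 0" and "ev f w = 0" and "w \<noteq> 0"
  shows "\<exists>l\<in>ac_eigenvalues scale v. poly (map_poly to_ac f) l = 0"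
proof -
  define rep where "rep x b = to_ac (representation Basis x b)" for x b
  define sc where "sc c g = (\<lambda>b. c * g b)" for c :: "'a alg_closure" and g :: "'v \<Rightarrow> 'a alg_closure"
  \<comment> \<open>Column \<open>b'\<close> of the matrix is \<open>rep (v b')\<close>, so
    \<open>rep\<close> intertwines \<open>v\<close> with \<open>A\<close>.\<close>
  define A where "A g b = (\<Sum>b'\<in>Basis. rep (v b') b * g b')" for g b
  have rep_add: "rep (x + y) b = rep x b + rep y b" for x y b
    by (simp add: rep_def representation_add independent_Basis span_Basis)
  have rep_scale: "rep (scale c x) b = to_ac c * rep x b" for c x b
    by (simp add: rep_def representation_scale independent_Basis span_Basis)
  have rep_0: "rep 0 = (\<lambda>b. 0)"
    by (rule HOL.ext) (simp add: rep_def representation_zero)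
  have rep_sum: "rep (sum h S) b = (\<Sum>i\<in>S. rep (h i) b)" for h b and S :: "'v set"
    by (induction S rule: infinite_finite_induct) (simp_all add: rep_add rep_0)
  have expand: "(\<Sum>b\<in>Basis. scale (representation Basis x b) b) = x" for x
    by (rule sum_representation_eq) (simp_all add: independent_Basis span_Basis finite_Basis)
  have rep_v: "rep (v x) = A (rep x)" for x
  proof
    fix b
    have "v x = (\<Sum>b'\<in>Basis. scale (representation Basis x b') (v b'))"
      using arg_cong[OF expand[of x], of v] by (simp add: v_sum v_scale)
    then show "rep (v x) b = A (rep x) b"
      by (simp add: rep_sum rep_scale A_def) (simp add: rep_def mult.commute)
  qed
  have outside: "rep x b = 0" if "b \<notin> Basis" for x b
    using that representation_ne_zero[of Basis x b] by (auto simp: rep_def)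
  interpret A: vector_space_endo sc A
    by unfold_locales (auto simp: sc_def A_def fun_eq_iff algebra_simps sum.distrib sum_distrib_left)
  have ev_A: "A.ev (map_poly to_ac g) (rep x) = rep (ev g x)" for g x
  proof (induction g)
    case 0
    show ?case by (simp add: rep_0 zero_fun_def)
  next
    case (pCons a g)
    then have "A.ev (map_poly to_ac (pCons a g)) (rep x) = sc (to_ac a) (rep x) + A (rep (ev g x))"
      by (simp only: map_poly_to_ac_pCons A.ev_pCons)
    also have "\<dots> = rep (ev (pCons a g) x)"
      by (rule HOL.ext) (simp add: sc_def ev_pCons rep_add rep_scale rep_v)
    finally show ?case .
  qed
  \<comment> \<open>Support on the basis ensures that the nonzero eigenfunction restricts to a
    nonzero vector indexed by \<open>bs\<close>.\<close>
  have A_outside: "A.ev g (rep x) b = 0" if "b \<notin> Basis" for g x b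
  proof (induction g)
    case 0
    show ?case by simp
  next
    case (pCons a g)
    have "A.ev (pCons a g) (rep x) b = sc a (rep x) b + A (A.ev g (rep x)) b"
      by (simp add: A.ev_pCons)
    also have "\<dots> = 0" using that by (simp add: sc_def A_def outside)
    finally show ?case .
  qed
  have "rep w \<noteq> 0"
  proof
    assume "rep w = 0"
    then have "representation Basis w b = 0" for b by (simp add: rep_def fun_eq_iff)
    then have "w = 0" using expand[of w] by simp
    with assms(3) show False by simp
  qed
  moreover have "map_poly to_ac f \<noteq> 0" using assms(1) by (simp add: map_poly_eq_0_iff)
  moreover have "A.ev (map_poly to_ac f) (rep w) = 0"
    by (simp add: ev_A assms(2) rep_0 zero_fun_def)
  ultimately obtain l g where l: "poly (map_poly to_ac f) l = 0"
    and g: "A.ev g (rep w) \<noteq> 0" "A (A.ev g (rep w)) = sc l (A.ev g (rep w))"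
    using A.eigenvector_exists[of "map_poly to_ac f" "rep w"] alg_closed_imp_poly_has_root by blast
  define z where "z = A.ev g (rep w)"
  obtain bs where bs: "set bs = Basis" "distinct bs"
    using finite_distinct_list[OF finite_Basis] by blast
  define n where "n = length bs"
  define M where "M = map_mat to_ac (matrix_of scale bs v)"
  have M: "M \<in> carrier_mat n n" by (simp add: M_def matrix_of_def n_def)
  have M_index: "M $$ (i, j) = rep (v (bs ! j)) (bs ! i)" if "i < n" "j < n" for i j
    using that by (simp add: M_def matrix_of_def n_def rep_def bs(1))
  define zv where "zv = vec n (\<lambda>i. z (bs ! i))"
  have "M *\<^sub>v zv = l \<cdot>\<^sub>v zv"
  proof (rule eq_vecI)
    show "dim_vec (M *\<^sub>v zv) = dim_vec (l \<cdot>\<^sub>v zv)" using M by (simp add: zv_def)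
    fix i assume "i < dim_vec (l \<cdot>\<^sub>v zv)"
    then have i: "i < n" by (simp add: zv_def)
    have "(M *\<^sub>v zv) $ i = (\<Sum>j\<in>{0..<n}. rep (v (bs ! j)) (bs ! i) * z (bs ! j))"
      using M i by (simp add: scalar_prod_def zv_def M_index)
    also have "\<dots> = (\<Sum>b\<in>Basis. rep (v b) (bs ! i) * z b)"
      by (rule sum.reindex_bij_betw) (use bij_betw_nth[OF bs(2) _ refl, of "{0..<n}"] bs(1) in
          \<open>simp add: n_def atLeast0LessThan\<close>)
    also have "\<dots> = A z (bs ! i)" by (simp add: A_def)
    also have "\<dots> = l * z (bs ! i)" using g(2) by (simp add: z_def sc_def fun_eq_iff)
    finally show "(M *\<^sub>v zv) $ i = (l \<cdot>\<^sub>v zv) $ i" using i by (simp add: zv_def)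
  qed
  moreover have "zv \<noteq> 0\<^sub>v n"
  proof
    assume "zv = 0\<^sub>v n"
    then have "z (bs ! i) = 0" if "i < n" for i
      using that by (metis zv_def index_vec index_zero_vec(1))
    then have "z b = 0" for b
      using A_outside[of b g w] bs(1) unfolding z_def[symmetric] by (cases "b \<in> Basis") (auto simp: in_set_conv_nth n_def)
    then show False using g(1) by (simp add: z_def[symmetric] fun_eq_iff)
  qed
  ultimately have "eigenvalue M l"
    unfolding eigenvalue_def eigenvector_def using M by (intro exI[of _ zv]) (auto simp: zv_def)
  moreover have "ordered_basis scale bs"
    using bs by (simp add: ordered_basis_def independent_Basis span_Basis)
  ultimately have "l \<in> ac_eigenvalues scale v"
    unfolding ac_eigenvalues_def M_def by blast
  with l show ?thesis by blast
qed

text \<open>If \<open>\<pi>\<close> does not divide \<open>f\<close>, then \<open>f(v)\<close> is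
  injective: a kernel vector would yield a common root of \<open>f\<close> and \<open>\<pi>\<close>,
  against Bezout. So an annihilator \<open>\<pi> ^ i * g\<close> of a vector, with \<open>g\<close>
  not divisible by \<open>\<pi>\<close>, can be replaced by \<open>\<pi> ^ i\<close>.\<close>

lemma eigenvalues_roots_imp_nilpotent:
  assumes irr: "Factorial_Ring.irreducible \<pi>" and deg: "0 < Polynomial.degree \<pi>"
    and roots: "\<And>l. l \<in> ac_eigenvalues scale v \<Longrightarrow> poly (map_poly to_ac \<pi>) l = 0"
  shows "\<exists>K. \<forall>y. ev (\<pi> ^ K) y = 0"
proof -
  have inj: "y = 0" if ndvd: "\<not> \<pi> dvd f" and fy: "ev f y = 0" for f y
  proof (rule ccontr)
    assume "y \<noteq> 0"
    have "f \<noteq> 0" using ndvd by auto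
    then obtain l where l: "l \<in> ac_eigenvalues scale v" "poly (map_poly to_ac f) l = 0"
      using eigenvalue_annihilator_root[OF _ fy \<open>y \<noteq> 0\<close>] by blast
    obtain g h where "g * f + h * \<pi> = 1" using irreducible_bezout[OF irr ndvd] by blast
    then have "poly (map_poly to_ac (g * f + h * \<pi>)) l = 1" by simp
    then show False using l(2) roots[OF l(1)]
      by (simp add: map_poly_to_ac_add map_poly_to_ac_mult)
  qed
  have "\<exists>K. ev (\<pi> ^ K) y = 0" for y
  proof -
    obtain f where f: "f \<noteq> 0" "ev f y = 0" using annihilating_poly_exists by blast
    obtain i g where g: "f = \<pi> ^ i * g" "\<not> \<pi> dvd g" using poly_power_decomp[OF deg f(1)] by blast
    have "ev g (ev (\<pi> ^ i) y) = 0" using f(2) unfolding g(1) ev_mult by (simp add: ev_commute)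
    from inj[OF g(2) this] show ?thesis by blast
  qed
  then obtain K where K: "\<And>y. ev (\<pi> ^ K y) y = 0" by metis
  \<comment> \<open>The sum bounds each exponent, so it serves all basis vectors at once.\<close>
  define m where "m = (\<Sum>b\<in>Basis. K b)"
  have "ev (\<pi> ^ m) b = 0" if "b \<in> Basis" for b
    using that by (intro ev_dvd[OF le_imp_power_dvd K]) (simp add: m_def member_le_sum finite_Basis)
  then have "ev (\<pi> ^ m) y = 0" for y
  proof -
    have "y \<in> span Basis" by (simp add: span_Basis)
    then show ?thesis
    proof (induction rule: span_induct_alt)
      case (step c b y)
      then show ?case using \<open>\<And>b. b \<in> Basis \<Longrightarrow> ev (\<pi> ^ m) b = 0\<close> by (simp add: ev_arg_add ev_arg_scale)
    qed simp
  qed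
  then show ?thesis by blast
qed

end

section \<open>The minimal polynomial of a difference of roots\<close>

lemma Root_iff:
  assumes "Polynomial.degree r = 2" "monic r"
  shows "x \<in> Root r \<longleftrightarrow> x ^ 2 = to_ac (tr r) * x - to_ac (Polynomial.coeff r 0)"
proof -
  have r: "r = [:Polynomial.coeff r 0, - tr r, 1:]"
    using assms
    by (intro poly_eqI) (auto simp: coeff_pCons tr_def numeral_2_eq_2 coeff_eq_0 split: nat.splits)
  have "poly (map_poly to_ac r) x = x ^ 2 - to_ac (tr r) * x + to_ac (Polynomial.coeff r 0)"
    by (subst r) (simp add: map_poly_to_ac_pCons power2_eq_square algebra_simps)
  then show ?thesis by (auto simp: Root_def algebra_simps)
qed

section \<open>Splitting fields of irreducible quadratics\<close>

lemma irreducible_root_not_in_base: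
  assumes "Factorial_Ring.irreducible r" "Polynomial.degree r = 2" "x \<in> Root r"
  shows "x \<noteq> to_ac c"
proof
  assume x: "x = to_ac c"
  have "poly (map_poly to_ac f) (to_ac c) = to_ac (poly f c)" for f
    by (induction f) (simp_all add: map_poly_to_ac_pCons)
  then have "poly r c = 0" using assms(3) by (simp add: Root_def x)
  then obtain h where h: "r = [:- c, 1:] * h" unfolding poly_eq_0_iff_dvd by (rule dvdE)
  from assms(1) h have "[:- c, 1:] dvd 1 \<or> h dvd 1" by (rule irreducibleD)
  then have "h dvd 1" by (auto simp: poly_dvd_1)
  then have "h \<noteq> 0" "Polynomial.degree h = 0" by (auto simp: poly_dvd_1)
  then have "Polynomial.degree r = 1" unfolding h by (subst Polynomial.degree_mult_eq) auto
  with assms(2) show False by simp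
qed

lemma splitting_field_intros:
  shows splitting_field_base: "to_ac c \<in> splitting_field r"
    and splitting_field_Root: "x \<in> Root r \<Longrightarrow> x \<in> splitting_field r"
    and splitting_field_add: "x \<in> splitting_field r \<Longrightarrow> y \<in> splitting_field r \<Longrightarrow> x + y \<in> splitting_field r"
    and splitting_field_mult: "x \<in> splitting_field r \<Longrightarrow> y \<in> splitting_field r \<Longrightarrow> x * y \<in> splitting_field r"
  using generate_field.eng_add[of x "ring_of_type_algebra" "range to_ac \<union> Root r" y]
    generate_field.eng_mult[of x "ring_of_type_algebra" "range to_ac \<union> Root r" y]
  by (auto simp: splitting_field_def ring_of_type_algebra_def intro: generate_field.incl)

text \<open>A root of \<open>r\<close> other than \<open>x\<close> equals \<open>tr r - x\<close>,
  so it lies in every extension of \<open>F\<close> that contains \<open>x\<close>.\<close>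

lemma splitting_field_subset:
  assumes r: "Polynomial.degree r = 2" "monic r"
    and x: "x \<in> Root r" "x \<in> splitting_field s"
  shows "splitting_field r \<subseteq> splitting_field s"
proof -
  have "Root r \<subseteq> splitting_field s"
  proof
    fix z assume "z \<in> Root r"
    then have "z ^ 2 - to_ac (tr r) * z = x ^ 2 - to_ac (tr r) * x"
      using x(1) by (simp add: Root_iff[OF r])
    then have "(z - x) * (z + x - to_ac (tr r)) = 0"
      by (simp add: algebra_simps power2_eq_square)
    then have "z = x \<or> z + x - to_ac (tr r) = 0" by simp
    then have "z = x \<or> z = to_ac (tr r) + to_ac (- 1) * x"
      by (auto simp: eq_diff_eq)
    then show "z \<in> splitting_field s"
    proof
      show ?thesis if "z = to_ac (tr r) + to_ac (- 1) * x"
        unfolding that by (intro splitting_field_add splitting_field_mult splitting_field_base x(2))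
    qed (simp add: x(2))
  qed
  then have sub: "range to_ac \<union> Root r \<subseteq> splitting_field s"
    using splitting_field_base by blast
  show ?thesis
  proof
    fix z assume "z \<in> splitting_field r"
    then show "z \<in> splitting_field s"
      unfolding splitting_field_def[of r]
    proof (induction rule: generate_field.induct)
      case (incl h)
      then show ?case using sub by blast
    qed (auto simp: splitting_field_def intro: generate_field.intros)
  qed
qed

text \<open>A nontrivial relation would put \<open>y\<close> in \<open>F(x)\<close> and then
  \<open>x\<close> in \<open>F(y)\<close>, so that the splitting fields would coincide.\<close>

lemma root_products_independent:
  assumes p: "Polynomial.degree p = 2" "monic p" "Factorial_Ring.irreducible p"
    and q: "Polynomial.degree q = 2" "monic q" "Factorial_Ring.irreducible q"
    and split: "splitting_field p \<noteq> splitting_field q"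
    and x: "x \<in> Root p" and y: "y \<in> Root q"
    and eq: "to_ac a + to_ac b * x + to_ac c * y + to_ac d * (x * y) = 0"
  shows "a = 0 \<and> b = 0 \<and> c = 0 \<and> d = 0"
proof -
  have indep: "a = 0 \<and> b = 0" if "to_ac a + to_ac b * x = 0" for a b
  proof -
    have "b = 0"
    proof (rule ccontr)
      assume "b \<noteq> 0"
      then have "x = - to_ac a / to_ac b"
        using minus_unique[OF that] by simp
      then have "x = to_ac (- a / b)" by simp
      with irreducible_root_not_in_base[OF p(3,1) x] show False by blast
    qed
    with that show ?thesis by simp
  qed
  have eq': "(to_ac a + to_ac b * x) + (to_ac c + to_ac d * x) * y = 0"
    using eq by (simp add: algebra_simps)
  have "to_ac c + to_ac d * x = 0"
  proof (rule ccontr)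
    assume nz: "to_ac c + to_ac d * x \<noteq> 0"
    define l where "l = tr p"
    define \<alpha> where "\<alpha> = Polynomial.coeff p 0"
    have xx: "x * x = to_ac l * x - to_ac \<alpha>"
      using x unfolding Root_iff[OF p(1,2)] by (simp add: l_def \<alpha>_def power2_eq_square)
    \<comment> \<open>The norm of \<open>c + d x\<close>. Its conjugate, with \<open>l - x\<close>
      in place of \<open>x\<close>, is the other factor in \<open>norm\<close> and clears the
      denominator when the relation is solved for \<open>y\<close>.\<close>
    define \<nu> where "\<nu> = c * c + c * d * l + d * d * \<alpha>"
    have norm: "(to_ac c + to_ac d * x) * (to_ac (c + d * l) - to_ac d * x) = to_ac \<nu>"
    proof -
      have "(to_ac c + to_ac d * x) * (to_ac (c + d * l) - to_ac d * x) =
          to_ac (c * c + c * d * l) + to_ac (d * d) * (to_ac l * x - x * x)"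
        by (simp add: algebra_simps)
      then show ?thesis by (simp add: xx \<nu>_def)
    qed
    have "to_ac (c + d * l) - to_ac d * x \<noteq> 0"
    proof
      assume "to_ac (c + d * l) - to_ac d * x = 0"
      then have "to_ac (c + d * l) + to_ac (- d) * x = 0" by simp
      from indep[OF this] nz show False by auto
    qed
    with norm nz have \<nu>: "\<nu> \<noteq> 0" by (metis mult_eq_0_iff to_ac_0)
    have "to_ac \<nu> * y = - (to_ac a + to_ac b * x) * (to_ac (c + d * l) - to_ac d * x)"
    proof -
      have *: "(to_ac c + to_ac d * x) * y = - (to_ac a + to_ac b * x)"
        by (rule minus_unique[OF eq', symmetric])
      have "to_ac \<nu> * y = ((to_ac c + to_ac d * x) * y) * (to_ac (c + d * l) - to_ac d * x)"
        unfolding norm[symmetric] by (simp only: mult_ac)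
      then show ?thesis unfolding * .
    qed
    also have "\<dots> = to_ac (- a * (c + d * l)) + to_ac (a * d - b * (c + d * l)) * x + to_ac (b * d) * (x * x)"
      by (simp add: algebra_simps)
    also have "\<dots> = to_ac (- a * (c + d * l) - b * d * \<alpha>) + to_ac (a * d - b * c) * x"
      by (simp add: xx algebra_simps)
    finally have y_eq: "y = to_ac ((- a * (c + d * l) - b * d * \<alpha>) / \<nu>) + to_ac ((a * d - b * c) / \<nu>) * x"
      using \<nu> by (simp add: divide_simps) (simp add: algebra_simps)
    define e where "e = (- a * (c + d * l) - b * d * \<alpha>) / \<nu>"
    define f where "f = (a * d - b * c) / \<nu>"
    have y_ef: "y = to_ac e + to_ac f * x" using y_eq by (simp only: e_def f_def)
    \<comment> \<open>As \<open>y\<close> is not in \<open>F\<close>, the expression of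
      \<open>y\<close> by \<open>x\<close> can be solved for \<open>x\<close>.\<close>
    have "f \<noteq> 0" using y_ef irreducible_root_not_in_base[OF q(3,1) y, of e] by auto
    then have f1: "to_ac (1 / f) * to_ac f = 1" by simp
    have "to_ac (1 / f) * y = to_ac (1 / f) * to_ac e + to_ac (1 / f) * to_ac f * x"
      by (simp only: y_ef distrib_left mult.assoc)
    then have x_eq: "x = to_ac (- e / f) + to_ac (1 / f) * y" unfolding f1 by simp
    have "y \<in> splitting_field p" unfolding y_ef
      by (intro splitting_field_add splitting_field_mult splitting_field_base splitting_field_Root x)
    moreover have "x \<in> splitting_field q" by (subst x_eq)
      (intro splitting_field_add splitting_field_mult splitting_field_base splitting_field_Root y)
    ultimately show False
      using split splitting_field_subset[OF p(1,2) x] splitting_field_subset[OF q(1,2) y] by blast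
  qed
  moreover from this have "to_ac a + to_ac b * x = 0"
    using eq' by simp
  ultimately show ?thesis using indep by blast
qed

section \<open>Irreducibility criterion and identities for differences of roots\<close>

lemma irreducible_of_minimal_degree:
  assumes "0 < Polynomial.degree \<pi>" and "poly (map_poly to_ac \<pi>) z = 0"
    and min: "\<And>f. f \<noteq> 0 \<Longrightarrow> poly (map_poly to_ac f) z = 0 \<Longrightarrow> Polynomial.degree \<pi> \<le> Polynomial.degree f"
  shows "Factorial_Ring.irreducible \<pi>"
proof (rule irreducibleI)
  show "\<pi> \<noteq> 0" "\<not> \<pi> dvd 1" using assms(1) by (auto simp: poly_dvd_1)
  fix a b assume ab: "\<pi> = a * b"
  then have nz: "a \<noteq> 0" "b \<noteq> 0" using \<open>\<pi> \<noteq> 0\<close> by auto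
  have deg: "Polynomial.degree \<pi> = Polynomial.degree a + Polynomial.degree b"
    unfolding ab using nz by (rule Polynomial.degree_mult_eq)
  \<comment> \<open>By minimality a factor vanishing at \<open>z\<close> has full degree, which
    leaves the other factor constant.\<close>
  have "poly (map_poly to_ac a) z = 0 \<or> poly (map_poly to_ac b) z = 0"
    using assms(2) by (simp add: ab map_poly_to_ac_mult)
  then have "Polynomial.degree b = 0 \<or> Polynomial.degree a = 0"
    using min[OF nz(1)] min[OF nz(2)] deg by auto
  then show "a dvd 1 \<or> b dvd 1" using nz by (auto simp: poly_dvd_1)
qed

text \<open>The value \<open>u\<close> of \<open>s\<close> at \<open>x - y\<close> is unchanged when
  \<open>x\<close>, \<open>y\<close> become \<open>l - x\<close>, \<open>m - y\<close>; replacing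
  \<open>y\<close> alone gives one further value. The two values have sum
  \<open>l m - 2 (a + b)\<close>, whence the linear coefficient, and their product is the constant
  term.\<close>

lemma quadratic_root_difference:
  fixes x y :: "'b::field"
  assumes x: "x * x = l * x - a" and y: "y * y = m * y - b"
  defines "u \<equiv> (x - y) * (x - y) - (l - m) * (x - y)"
  shows "(a - b) ^ 2 - (a + b) * l * m + b * l ^ 2 + a * m ^ 2 + u * (2 * (a + b) - l * m + u) = 0"
proof -
  have "(x - y) * (x - y) = x * x + y * y - 2 * (x * y)" by (simp add: algebra_simps)
  then have u: "u = m * x + l * y - 2 * (x * y) - a - b"
    unfolding u_def x y by (simp add: algebra_simps)
  \<comment> \<open>A polynomial identity in all the letters, with explicit cofactors for the two
    defining relations.\<close>
  have "(a - b) ^ 2 - (a + b) * l * m + b * l ^ 2 + a * m ^ 2 + u * (2 * (a + b) - l * m + u) =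
      (m ^ 2 - 4 * m * y + 4 * (y * y)) * (x * x - (l * x - a)) + (l ^ 2 - 4 * a) * (y * y - (m * y - b))"
    unfolding u by (simp add: algebra_simps power2_eq_square)
  then show ?thesis by (simp add: x y)
qed

text \<open>Coordinates of the square and the cube with respect to \<open>1\<close>,
  \<open>x\<close>, \<open>y\<close>, \<open>x y\<close>: they turn a relation of degree at most 3
  for \<open>x - y\<close> into linear equations.\<close>

lemma root_difference_powers:
  fixes x y :: "'b::field"
  assumes x: "x * x = l * x - a" and y: "y * y = m * y - b"
  shows "(x - y) * (x - y) = l * x + m * y - 2 * (x * y) - a - b"
    and "(x - y) * (x - y) * (x - y) = (l ^ 2 - a - 3 * b) * x + (3 * a + b - m ^ 2) * y +
      3 * (m - l) * (x * y) + (m * b - l * a)"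
proof -
  have "(x - y) * (x - y) = x * x + y * y - 2 * (x * y)" by (simp add: algebra_simps)
  then show "(x - y) * (x - y) = l * x + m * y - 2 * (x * y) - a - b"
    by (simp add: x y)
  have x3: "x * (x * x) = (l ^ 2 - a) * x - l * a"
  proof -
    have "x * (x * x) = l * (x * x) - a * x" unfolding x by (simp add: algebra_simps x)
    then show ?thesis by (simp add: x algebra_simps power2_eq_square)
  qed
  have y3: "y * (y * y) = (m ^ 2 - b) * y - m * b"
  proof -
    have "y * (y * y) = m * (y * y) - b * y" unfolding y by (simp add: algebra_simps y)
    then show ?thesis by (simp add: y algebra_simps power2_eq_square)
  qed
  have cube: "(x - y) * (x - y) * (x - y) = x * (x * x) - 3 * ((x * x) * y) + 3 * (x * (y * y)) - y * (y * y)"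
    by (simp add: algebra_simps)
  show "(x - y) * (x - y) * (x - y) = (l ^ 2 - a - 3 * b) * x + (3 * a + b - m ^ 2) * y +
      3 * (m - l) * (x * y) + (m * b - l * a)"
    unfolding cube x3 y3 unfolding x y by (simp add: algebra_simps)
qed

text \<open>The hypotheses are the coordinates at \<open>x\<close>, \<open>y\<close> and
  \<open>x y\<close> of a cubic relation for \<open>x - y\<close>. Adding the first two eliminates
  \<open>f1\<close>; the remaining 2 x 2 system in \<open>f2\<close>, \<open>f3\<close> has the
  difference of the discriminants as determinant.\<close>

lemma root_difference_elimination:
  fixes l m a b f1 f2 f3 :: "'b::field"
  assumes e1: "f1 + l * f2 + (l ^ 2 - a - 3 * b) * f3 = 0"
    and e2: "- f1 + m * f2 + (3 * a + b - m ^ 2) * f3 = 0"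
    and e3: "- 2 * f2 + 3 * (m - l) * f3 = 0"
  shows "((m ^ 2 - 4 * b) - (l ^ 2 - 4 * a)) * f3 = 0"
    and "((m ^ 2 - 4 * b) - (l ^ 2 - 4 * a)) * f2 = 0"
proof -
  have e12: "(l + m) * f2 + (l ^ 2 - m ^ 2 + 2 * (a - b)) * f3 = 0"
    using arg_cong2[OF e1 e2, of "(+)"] by (simp add: algebra_simps)
  have "((m ^ 2 - 4 * b) - (l ^ 2 - 4 * a)) * f3 =
    2 * ((l + m) * f2 + (l ^ 2 - m ^ 2 + 2 * (a - b)) * f3) + (l + m) * (- 2 * f2 + 3 * (m - l) * f3)"
    by (simp add: algebra_simps power2_eq_square)
  also have "\<dots> = 0" by (simp only: e12 e3 mult_zero_right add_0 diff_0_right)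
  finally show "((m ^ 2 - 4 * b) - (l ^ 2 - 4 * a)) * f3 = 0" .
  have "((m ^ 2 - 4 * b) - (l ^ 2 - 4 * a)) * f2 =
    3 * (m - l) * ((l + m) * f2 + (l ^ 2 - m ^ 2 + 2 * (a - b)) * f3) -
    (l ^ 2 - m ^ 2 + 2 * (a - b)) * (- 2 * f2 + 3 * (m - l) * f3)"
    by (simp add: algebra_simps power2_eq_square)
  also have "\<dots> = 0" by (simp only: e12 e3 mult_zero_right add_0 diff_0_right)
  finally show "((m ^ 2 - 4 * b) - (l ^ 2 - 4 * a)) * f2 = 0" .
qed

text \<open>A difference of squares: \<open>2 x - l\<close> squares to the discriminant
  \<open>l^2 - 4 a\<close>, and likewise for \<open>y\<close>.\<close>

lemma equal_discriminants:
  fixes x y :: "'b::field"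
  assumes x: "x * x = l * x - a" and y: "y * y = m * y - b" and "l ^ 2 - 4 * a = m ^ 2 - 4 * b"
  shows "(2 * x - l - (2 * y - m)) * (2 * x - l + (2 * y - m)) = 0"
proof -
  have "(2 * x - l - (2 * y - m)) * (2 * x - l + (2 * y - m)) =
     4 * (x * x) - 4 * (l * x) + l ^ 2 - (4 * (y * y) - 4 * (m * y) + m ^ 2)"
    by (simp add: algebra_simps power2_eq_square)
  also have "\<dots> = (l ^ 2 - 4 * a) - (m ^ 2 - 4 * b)" by (simp add: x y algebra_simps)
  finally show ?thesis using assms(3) by simp
qed

lemma equal_discriminants_char_2:
  fixes l m a b :: "'b::field"
  assumes "(2::'b) = 0" and "l ^ 2 - 4 * a = m ^ 2 - 4 * b"
  shows "(l - m) ^ 2 = 0"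
proof -
  have "(l - m) ^ 2 = (l ^ 2 - 4 * a) - (m ^ 2 - 4 * b) + 2 * (2 * a - 2 * b + m ^ 2 - l * m)"
    by (simp add: algebra_simps power2_eq_square)
  then show ?thesis using assms by simp
qed

lemma square_root_difference_char_2:
  fixes x y :: "'b::field"
  assumes x: "x * x = - a" and y: "y * y = - b" and two: "(2::'b) = 0"
  shows "a + b + (x - y) * (x - y) = 0"
proof -
  have "a + b + (x - y) * (x - y) = a + b + x * x + y * y - 2 * (x * y)" by (simp add: algebra_simps)
  then show ?thesis by (simp add: x y two)
qed

text \<open>If the discriminants differ, \<open>x - y\<close> has degree 4 over \<open>F\<close>,
  with the quadratic in \<open>s\<close> found above as minimal polynomial. If they agree, the
  characteristic is 2 and the traces agree, so both traces are 0 and \<open>s = t^2\<close>; the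
  minimal polynomial is then \<open>s + \<alpha> + \<beta>\<close>.\<close>

lemma root_difference_poly:
  fixes p q :: "'a::field poly"
  assumes p: "Polynomial.degree p = 2" "monic p" "Factorial_Ring.irreducible p"
    and q: "Polynomial.degree q = 2" "monic q" "Factorial_Ring.irreducible q"
    and split: "splitting_field p \<noteq> splitting_field q"
    and char: "CHAR('a) \<noteq> 2 \<or> (tr p = 0 \<and> tr q = 0) \<or> tr p \<noteq> tr q"
  shows "\<exists>\<rho>. 0 < Polynomial.degree \<rho> \<and> Factorial_Ring.irreducible (\<rho> \<circ>\<^sub>p [:0, - (tr p - tr q), 1:]) \<and>
    (\<forall>l\<in>root_differences p q. poly (map_poly to_ac (\<rho> \<circ>\<^sub>p [:0, - (tr p - tr q), 1:])) l = 0)"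
proof -
  define l m \<alpha> \<beta> where "l = tr p" and "m = tr q"
    and "\<alpha> = Polynomial.coeff p 0" and "\<beta> = Polynomial.coeff q 0"
  have sq_p: "x * x = to_ac l * x - to_ac \<alpha>" if "x \<in> Root p" for x
    using that unfolding Root_iff[OF p(1,2)] by (simp add: l_def \<alpha>_def power2_eq_square)
  have sq_q: "y * y = to_ac m * y - to_ac \<beta>" if "y \<in> Root q" for y
    using that unfolding Root_iff[OF q(1,2)] by (simp add: m_def \<beta>_def power2_eq_square)
  have "\<exists>x. x \<in> Root r" if "Polynomial.degree r = 2" for r :: "'a poly"
  proof -
    have "Polynomial.degree (map_poly to_ac r) = 2"
      using that by (subst Polynomial.degree_map_poly) auto
    then show ?thesis
      using alg_closed_imp_poly_has_root[of "map_poly to_ac r"] by (simp add: Root_def)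
  qed
  then obtain x y where x: "x \<in> Root p" and y: "y \<in> Root q" using p(1) q(1) by blast
  note indep = root_products_independent[OF p q split x y]
  note xx = sq_p[OF x] and yy = sq_q[OF y]
  define s where "s = [:0, - (l - m), 1:]"
  show ?thesis
  proof (cases "l ^ 2 - 4 * \<alpha> = m ^ 2 - 4 * \<beta>")
    case False
    define c1 c0 where "c1 = 2 * (\<alpha> + \<beta>) - l * m"
      and "c0 = (\<alpha> - \<beta>) ^ 2 - (\<alpha> + \<beta>) * l * m + \<beta> * l ^ 2 + \<alpha> * m ^ 2"
    define \<pi> where "\<pi> = [:c0, c1, 1:] \<circ>\<^sub>p s"
    have deg: "Polynomial.degree \<pi> = 4" by (simp add: \<pi>_def s_def Polynomial.degree_pcompose)
    have root: "poly (map_poly to_ac \<pi>) (x - y) = 0" if "x \<in> Root p" "y \<in> Root q" for x y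
    proof -
      let ?z = "x - y"
      define u where "u = ?z * ?z - to_ac (l - m) * ?z"
      have "poly (map_poly to_ac \<pi>) ?z = to_ac c0 + u * (to_ac c1 + u)"
        by (simp add: \<pi>_def s_def u_def pcompose_pCons map_poly_to_ac_pCons algebra_simps)
      also have "\<dots> = 0"
        using quadratic_root_difference[OF sq_p[OF that(1)] sq_q[OF that(2)]]
        by (simp add: u_def c0_def c1_def)
      finally show ?thesis .
    qed
    have "Factorial_Ring.irreducible \<pi>"
    proof (rule irreducible_of_minimal_degree)
      show "0 < Polynomial.degree \<pi>" by (simp add: deg)
      show "poly (map_poly to_ac \<pi>) (x - y) = 0" by (rule root[OF x y])
      fix f assume "f \<noteq> 0" and f: "poly (map_poly to_ac f) (x - y) = 0"
      show "Polynomial.degree \<pi> \<le> Polynomial.degree f"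
      proof (rule ccontr)
        assume "\<not> ?thesis"
        then have df: "Polynomial.degree f < 4" by (simp add: deg)
        define f0 f1 f2 f3 where "f0 = Polynomial.coeff f 0" and "f1 = Polynomial.coeff f 1"
          and "f2 = Polynomial.coeff f 2" and "f3 = Polynomial.coeff f 3"
        have f_eq: "f = [:f0, f1, f2, f3:]"
          using df by (intro poly_eqI) (auto simp: coeff_pCons f0_def f1_def f2_def f3_def
              numeral_2_eq_2 numeral_3_eq_3 coeff_eq_0 split: nat.splits)
        let ?z = "x - y"
        have "to_ac f0 + to_ac f1 * ?z + to_ac f2 * (?z * ?z) + to_ac f3 * (?z * ?z * ?z) = 0"
          using f by (simp add: f_eq map_poly_to_ac_pCons algebra_simps)
        moreover have "to_ac (f0 - (\<alpha> + \<beta>) * f2 + (m * \<beta> - l * \<alpha>) * f3) +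
            to_ac (f1 + l * f2 + (l ^ 2 - \<alpha> - 3 * \<beta>) * f3) * x +
            to_ac (- f1 + m * f2 + (3 * \<alpha> + \<beta> - m ^ 2) * f3) * y +
            to_ac (- 2 * f2 + 3 * (m - l) * f3) * (x * y) =
            to_ac f0 + to_ac f1 * ?z + to_ac f2 * (?z * ?z) + to_ac f3 * (?z * ?z * ?z)"
          unfolding root_difference_powers(2)[OF xx yy] unfolding root_difference_powers(1)[OF xx yy]
          by (simp add: algebra_simps)
        ultimately have eq: "to_ac (f0 - (\<alpha> + \<beta>) * f2 + (m * \<beta> - l * \<alpha>) * f3) +
            to_ac (f1 + l * f2 + (l ^ 2 - \<alpha> - 3 * \<beta>) * f3) * x +
            to_ac (- f1 + m * f2 + (3 * \<alpha> + \<beta> - m ^ 2) * f3) * y +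
            to_ac (- 2 * f2 + 3 * (m - l) * f3) * (x * y) = 0"
          by simp
        from indep[OF eq] have
          e0: "f0 - (\<alpha> + \<beta>) * f2 + (m * \<beta> - l * \<alpha>) * f3 = 0"
          and e1: "f1 + l * f2 + (l ^ 2 - \<alpha> - 3 * \<beta>) * f3 = 0"
          and e2: "- f1 + m * f2 + (3 * \<alpha> + \<beta> - m ^ 2) * f3 = 0"
          and e3: "- 2 * f2 + 3 * (m - l) * f3 = 0"
          by blast+
        have "f3 = 0" "f2 = 0"
          using root_difference_elimination[OF e1 e2 e3] False by auto
        with e0 e1 have "f0 = 0" "f1 = 0" by simp_all
        with \<open>f2 = 0\<close> \<open>f3 = 0\<close> \<open>f \<noteq> 0\<close> f_eq show False by simp
      qed
    qed
    then show ?thesis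
      using root by (intro exI[of _ "[:c0, c1, 1:]"])
        (auto simp: \<pi>_def s_def l_def m_def root_differences_def)
  next
    case True
    \<comment> \<open>Otherwise \<open>2 x - l\<close> and \<open>2 y - m\<close> agree up to sign,
      which is a nontrivial linear relation between \<open>1\<close>, \<open>x\<close> and
      \<open>y\<close>.\<close>
    have "(2::'a) = 0"
    proof (rule ccontr)
      assume two: "(2::'a) \<noteq> 0"
      let ?X = "2 * x - to_ac l" and ?Y = "2 * y - to_ac m"
      have "to_ac (l ^ 2 - 4 * \<alpha>) = to_ac (m ^ 2 - 4 * \<beta>)" using True by (rule arg_cong)
      then have "(?X - ?Y) * (?X + ?Y) = 0"
        by (intro equal_discriminants[OF xx yy]) simp
      then have "?X - ?Y = 0 \<or> ?X + ?Y = 0" by simp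
      then have "to_ac (m - l) + to_ac 2 * x + to_ac (- 2) * y + to_ac 0 * (x * y) = 0 \<or>
          to_ac (- l - m) + to_ac 2 * x + to_ac 2 * y + to_ac 0 * (x * y) = 0"
        by (simp add: algebra_simps)
      then show False using indep two by metis
    qed
    then have char2: "CHAR('a) = 2"
      using CHAR_eq_posI[of 2] by (auto simp: numeral_2_eq_2 less_Suc_eq)
    have "(l - m) ^ 2 = 0" using \<open>(2::'a) = 0\<close> True by (rule equal_discriminants_char_2)
    then have "l = m" by simp
    \<comment> \<open>In characteristic 2 the assumption allows equal traces only if both are
      0.\<close>
    with char char2 have lm: "l = 0" "m = 0" by (auto simp: l_def m_def)
    have two_ac: "(2::'a alg_closure) = 0"
      using arg_cong[OF \<open>(2::'a) = 0\<close>, of to_ac] by simp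
    define \<pi> where "\<pi> = [:\<alpha> + \<beta>, 1:] \<circ>\<^sub>p s"
    have deg: "Polynomial.degree \<pi> = 2" by (simp add: \<pi>_def s_def Polynomial.degree_pcompose)
    have root: "poly (map_poly to_ac \<pi>) (x - y) = 0" if "x \<in> Root p" "y \<in> Root q" for x y
    proof -
      have "poly (map_poly to_ac \<pi>) (x - y) = to_ac \<alpha> + to_ac \<beta> + (x - y) * (x - y)"
        by (simp add: \<pi>_def s_def lm pcompose_pCons map_poly_to_ac_pCons algebra_simps)
      also have "\<dots> = 0"
        by (rule square_root_difference_char_2[OF _ _ two_ac])
          (simp_all add: sq_p[OF that(1)] sq_q[OF that(2)] lm)
      finally show ?thesis .
    qed
    have "Factorial_Ring.irreducible \<pi>"
    proof (rule irreducible_of_minimal_degree)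
      show "0 < Polynomial.degree \<pi>" by (simp add: deg)
      show "poly (map_poly to_ac \<pi>) (x - y) = 0" by (rule root[OF x y])
      fix f assume "f \<noteq> 0" and f: "poly (map_poly to_ac f) (x - y) = 0"
      show "Polynomial.degree \<pi> \<le> Polynomial.degree f"
      proof (rule ccontr)
        assume "\<not> ?thesis"
        then have df: "Polynomial.degree f < 2" by (simp add: deg)
        define f0 f1 where "f0 = Polynomial.coeff f 0" and "f1 = Polynomial.coeff f 1"
        have f_eq: "f = [:f0, f1:]"
          using df by (intro poly_eqI) (auto simp: coeff_pCons f0_def f1_def coeff_eq_0 split: nat.splits)
        have "to_ac f0 + to_ac f1 * x + to_ac (- f1) * y + to_ac 0 * (x * y) = 0"
          using f by (simp add: f_eq map_poly_to_ac_pCons algebra_simps)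
        from indep[OF this] have "f0 = 0" "f1 = 0" by blast+
        with \<open>f \<noteq> 0\<close> f_eq show False by simp
      qed
    qed
    then show ?thesis
      using root by (intro exI[of _ "[:\<alpha> + \<beta>, 1:]"])
        (auto simp: \<pi>_def s_def l_def m_def root_differences_def)
  qed
qed

theorem theorem6p1:
  fixes p q :: "'a::field poly"
    and scale :: "'a \<Rightarrow> 'v::ab_group_add \<Rightarrow> 'v"
    and Basis :: "'v set"
    and v :: "'v \<Rightarrow> 'v"
  assumes "monic p" and "Polynomial.degree p = 2"
    and "monic q" and "Polynomial.degree q = 2"
    and "Factorial_Ring.irreducible p" and "Factorial_Ring.irreducible q"
    and "splitting_field p \<noteq> splitting_field q"
    and "CHAR('a) \<noteq> 2 \<or> (tr p = 0 \<and> tr q = 0) \<or> tr p \<noteq> tr q"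
    and "finite_dimensional_vector_space scale Basis"
    and "Vector_Spaces.linear scale scale v"
    and "exceptional scale p q v"
  shows "symplectic_difference (double_scale scale) (double_space scale) p q
           (symplectic_extension v)"
proof -
  interpret finite_dimensional_vector_space scale Basis by fact
  interpret fin_dim_endo scale v Basis
    by unfold_locales (use assms(10) in \<open>simp_all add: Vector_Spaces.linear_iff\<close>)
  let ?\<pi> = "\<lambda>\<rho>. \<rho> \<circ>\<^sub>p [:0, - (tr p - tr q), 1:]"
  obtain \<rho> where \<rho>: "0 < Polynomial.degree \<rho>" "Factorial_Ring.irreducible (?\<pi> \<rho>)"
    and roots: "\<And>l. l \<in> root_differences p q \<Longrightarrow> poly (map_poly to_ac (?\<pi> \<rho>)) l = 0"
    using root_difference_poly[OF assms(2,1,5,4,3,6-8)] by blast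
  \<comment> \<open>All eigenvalues of \<open>v\<close> are roots of one irreducible polynomial, so
    the whole space is a single primary component.\<close>
  have "\<exists>K. \<forall>y. ev (?\<pi> \<rho> ^ K) y = 0"
  proof (rule eigenvalues_roots_imp_nilpotent[OF \<rho>(2)])
    show "0 < Polynomial.degree (?\<pi> \<rho>)" using \<rho>(1) by (simp add: Polynomial.degree_pcompose)
    show "poly (map_poly to_ac (?\<pi> \<rho>)) l = 0" if "l \<in> ac_eigenvalues scale v" for l
      using that assms(11) roots unfolding exceptional_def by blast
  qed
  then obtain K where K: "\<And>y. ev (?\<pi> \<rho> ^ K) y = 0" by blast
  have "splits scale (tr p) (tr q) (Polynomial.coeff q 0 - Polynomial.coeff p 0) v UNIV"
    by (rule splits_primary[OF \<rho>(2,1) K]) simp_all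
  then show ?thesis
    by (rule splits_symplectic_difference[OF assms(2,1,4,3)])
qed

end
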